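(* Let $\mathscr E$ be a pure exchange mixed economy with asymmetric information admitting finitely many information partitions $\mathscr Q_1,\dots,\mathscr Q_n$ (as defined in the context), satisfying (A$_1'$), (A$_2$), (A$_3$), (A$_4'$), (A$_5$) and (A$_6$), and let $\mathscr A$ be the set of its large agents. If either $|\mathscr A|\ge2$ or $\mathscr A=\emptyset$, then $\mathbf C^{fine}(\mathscr E)\subseteq\mathbf C(\mathscr E)$, i.e. the fine core is contained in the ex-post core.
   Context: Economy. $\mathscr E = \{(\Omega,\mathscr F,\mathbb P);(T,\Sigma,\mu);\mathbb R^\ell_+;(\mathscr F_t,U(t,\cdot,\cdot),a(t,\cdot),\mathbb P_t)_{t\in T}\}$, where $(\Omega,\mathscr F,\mathbb P)$ is a complete probability space (states of nature), $(T,\Sigma,\mu)$ is a complete, finite, positive measure space of agents, and $\mathbb R^\ell_+$ is the consumption set of each agent in each state. $T=T_0\cup T_1$ with $T_0$ the atomless part (small agents) and $T_1$ the union of the at most countable family $\mathscr A=\{A_n:n\ge1\}$ of $\mu$-atoms (large agents); each atom $A_n$ is treated as a single agent, and $T_1$ is identified with $\mathscr A$. Agent $t$ has: private information $\mathscr F_t$, the $\sigma$-algebra generated by a measurable partition $\Pi_t$ of $\Omega$; a state-dependent utility $U(t,\cdot,\cdot):\Omega\times\mathbb R^\ell_+\to\mathbb R$; a state-dependent initial endowment $a(t,\cdot):\Omega\to\mathbb R^\ell_+$; a prior $\mathbb P_t$, a probability measure on $\mathscr F$. The quadruple $(\mathscr F_t,U(t,\cdot,\cdot),a(t,\cdot),\mathbb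 P_t)$ is the agent's characteristics (type). Each agent's information partition $\Pi_t$ is a member of $\{\mathscr Q_1,\dots,\mathscr Q_n\}$. A coalition is a set $S\in\Sigma$ with $\mu(S)>0$. For a coalition $S$, $S^i=\{t\in S:\Pi_t=\mathscr Q_i\}$ (measurable) and $\mathfrak P(S)=\{i:\mu(S^i)>0,\ 1\le i\le n\}$. $\bigvee\{\mathscr Q_i:i\in\mathfrak P(S)\}$ is the $\sigma$-algebra on $\Omega$ generated by the common refinement of the partitions $\mathscr Q_i$, $i\in\mathfrak P(S)$. For $x,y\in\mathbb R^\ell$: $x<y$ means $x\le y$ coordinatewise and $x\ne y$; $x\ll y$ means $x_k<y_k$ for all $k$. $u:\mathbb R^\ell_+\to\mathbb R$ is strictly increasing if $u(x)<u(y)$ whenever $x<y$. Assumptions. (A$_1'$) $a:T\times\Omega\to\mathbb R^\ell_+$ is $\Sigma\otimes\mathscr F$-measurable, and for each $\omega\in\Omega$, $a(\cdot,\omega)$ is (Bochner) integrable and $a(\cdot,\omega)\gg0$ $\mu$-a.e. on $T$. (A$_2$) $U(\cdot,\cdot,x)$ is $\Sigma\otimes\mathscr F$-measurable for all $x\in\mathbb R^\ell_+$. (A$_3$) $U(t,\omega,\cdot)$ is continuous and strictly increasing for each $(t,\omega)\in T\times\Omega$. (A$_4'$) $U(t,\omega,\cdot)$ is quasi-concave for each $(t,\omega)\in T_1\times\Omega$. (A$_5$) $\mu(T^i)>0$ for all $1\le i\le n$, $T=\bigcup\{T^i:1\le i\le n\}$ and $\bigvee_{i=1}^n\mathscr Q_i=\mathscr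 F$. (A$_6$) All large agents have the same characteristics. An assignment is a function $f:T\times\Omega\to\mathbb R^\ell_+$ such that $f(\cdot,\omega)\in L_1(\mu,\mathbb R^\ell)$ for every $\omega$ and $f(t,\cdot)$ is $\mathscr F$-measurable for every $t$. An allocation is an assignment $f$ with $\int_T f(\cdot,\omega)\,d\mu=\int_T a(\cdot,\omega)\,d\mu$ for every $\omega\in\Omega$. Ex-post core. An allocation $f$ is ex-post blocked by a coalition $S$ if there exist $\omega_0\in\Omega$ and an assignment $g$ such that $\int_S g(\cdot,\omega_0)\,d\mu=\int_S a(\cdot,\omega_0)\,d\mu$ and $U(t,\omega_0,g(t,\omega_0))>U(t,\omega_0,f(t,\omega_0))$ $\mu$-a.e. on $S$. $\mathbf C(\mathscr E)$ is the set of allocations not ex-post blocked by any coalition. Fine core. An information structure for a coalition $S$ is a family $\{\mathscr G_t:t\in S\}$ of $\sigma$-algebras on $\Omega$ with $\mathscr G_t\subseteq\mathscr F$ for all $t\in S$ and $\{t\in S:\mathscr G_t=\mathscr G\}\in\Sigma$ for every $\sigma$-algebra $\mathscr G\subseteq\mathscr F$. It is a communication system for $S$ if $\mathscr F_t\subseteq\mathscr G_t\subseteq\bigvee\{\mathscr Q_i:i\in\mathfrak P(S)\}$ $\mu$-a.e. on $S$. An allocation $f$ is fine blocked by a coalition $S$ if there are an allocation $g$, a communication system $\{\mathscr G_t:t\in S\}$ for $S$ and a nonempty event $\Omega_0\in\bigcap_{t\in S}\mathscr G_t$ such that for all $\omega\in\Omega_0$: $\int_S g(\cdot,\omega)\,d\mu=\int_S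 a(\cdot,\omega)\,d\mu$ and $\mathbb E_t[U(t,\cdot,g(t,\cdot))|\mathscr G_t](\omega)>\mathbb E_t[U(t,\cdot,f(t,\cdot))|\mathscr G_t](\omega)$ $\mu$-a.e. on $S$. Here $\mathbb E_t[\,\cdot\,|\mathscr G_t]$ is conditional expectation with respect to $\mathbb P_t$, with the convention that the conditional expectation of a $\mathscr G_t$-measurable function is that function itself. $\mathbf C^{fine}(\mathscr E)$ is the set of allocations that are not fine blocked by any coalition. *)

theory Defs
  imports "HOL-Probability.Probability"
begin

section \<open>Mixed economies with asymmetric information\<close>

text \<open>
  Commodity bundles are vectors in \<open>real ^ 'l\<close>. The library orders are the coordinatewise ones:
  \<open>x \<le> y\<close> in every coordinate, and \<open>x < y\<close> iff \<open>x \<le> y\<close> and \<open>x \<noteq> y\<close>.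
  Functions of agents, states and bundles are total in HOL; only their values on
  \<open>space (agents E)\<close>, \<open>space (states E)\<close> and \<open>orthant\<close> matter.
\<close>

definition orthant :: "(real ^ 'l) set" where
  "orthant = {x. 0 \<le> x}"

definition strictly_positive :: "real ^ 'l \<Rightarrow> bool" where
  "strictly_positive x \<longleftrightarrow> (\<forall>k. 0 < x $ k)"

definition quasi_concave_on :: "'a::real_vector set \<Rightarrow> ('a \<Rightarrow> real) \<Rightarrow> bool" where
  "quasi_concave_on X u \<longleftrightarrow>
     (\<forall>x\<in>X. \<forall>y\<in>X. \<forall>r\<in>{0..1}. min (u x) (u y) \<le> u (r *\<^sub>R x + (1 - r) *\<^sub>R y))"

definition measure_atom :: "'a measure \<Rightarrow> 'a set \<Rightarrow> bool" where
  "measure_atom M A \<longleftrightarrow> A \<in> sets M \<and> emeasure M A > 0 \<and>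
     (\<forall>B\<in>sets M. B \<subseteq> A \<longrightarrow> emeasure M B = 0 \<or> emeasure M (A - B) = 0)"

record ('w, 't, 'l::finite) economy_data =
  states :: "'w measure"
  agents :: "'t measure"
  large :: "'t set set"  \<comment> \<open>the family of atoms, i.e. of large agents\<close>
  npart :: nat
  partn :: "nat \<Rightarrow> 'w set set"  \<comment> \<open>relevant indices: \<open>1..npart\<close>\<close>
  info :: "'t \<Rightarrow> 'w set set"  \<comment> \<open>the information partition of an agent\<close>
  util :: "'t \<Rightarrow> 'w \<Rightarrow> real ^ 'l \<Rightarrow> real"
  endow :: "'t \<Rightarrow> 'w \<Rightarrow> real ^ 'l"
  prior :: "'t \<Rightarrow> 'w measure"

definition large_part :: "('w, 't, 'l::finite) economy_data \<Rightarrow> 't set" where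
  "large_part E = \<Union> (large E)"

definition small_part :: "('w, 't, 'l::finite) economy_data \<Rightarrow> 't set" where
  "small_part E = space (agents E) - large_part E"

definition info_algebra :: "('w, 't, 'l::finite) economy_data \<Rightarrow> 't \<Rightarrow> 'w set set" where
  "info_algebra E t = sigma_sets (space (states E)) (info E t)"

definition join :: "('w, 't, 'l::finite) economy_data \<Rightarrow> nat set \<Rightarrow> 'w set set" where
  "join E I = sigma_sets (space (states E)) (common_refinement (partn E ` I))"

definition same_characteristics :: "('w, 't, 'l::finite) economy_data \<Rightarrow> 't \<Rightarrow> 't \<Rightarrow> bool" where
  "same_characteristics E s t \<longleftrightarrow>
     info_algebra E s = info_algebra E t \<and>
     (\<forall>\<omega>\<in>space (states E). \<forall>x\<in>orthant. util E s \<omega> x = util E t \<omega> x) \<and>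
     (\<forall>\<omega>\<in>space (states E). endow E s \<omega> = endow E t \<omega>) \<and>
     prior E s = prior E t"

definition coalition :: "('w, 't, 'l::finite) economy_data \<Rightarrow> 't set \<Rightarrow> bool" where
  "coalition E S \<longleftrightarrow> S \<in> sets (agents E) \<and> emeasure (agents E) S > 0"

definition members_with :: "('w, 't, 'l::finite) economy_data \<Rightarrow> 't set \<Rightarrow> nat \<Rightarrow> 't set" where
  "members_with E S i = {t \<in> S. info E t = partn E i}"

definition active_parts :: "('w, 't, 'l::finite) economy_data \<Rightarrow> 't set \<Rightarrow> nat set" where
  "active_parts E S = {i \<in> {1..npart E}. emeasure (agents E) (members_with E S i) > 0}"

text \<open>
  An atom need not be a single point of the agent space. That it acts as one agent is expressed by
  its points sharing the same characteristics; integrable functions are almost everywhere constant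
  on it in any case. Identifying every atom with one point is the special case in which all members
  of \<open>large E\<close> are singletons. Atoms are pairwise disjoint, so that \<open>large E\<close> has as many elements
  as there are large agents.
\<close>

definition mixed_economy :: "('w, 't, 'l::finite) economy_data \<Rightarrow> bool" where
  "mixed_economy E \<longleftrightarrow>
     prob_space (states E) \<and> complete_measure (states E) \<and>
     finite_measure (agents E) \<and> complete_measure (agents E) \<and>
     countable (large E) \<and> disjoint (large E) \<and>
     (\<forall>A\<in>large E. measure_atom (agents E) A) \<and>
     (\<forall>A\<in>large E. \<forall>s\<in>A. \<forall>t\<in>A. same_characteristics E s t) \<and>
     (\<forall>A. A \<subseteq> small_part E \<longrightarrow> \<not> measure_atom (agents E) A) \<and>
     1 \<le> npart E \<and>
     (\<forall>i\<in>{1..npart E}. partition_on (space (states E)) (partn E i) \<and>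
                        partn E i \<subseteq> sets (states E)) \<and>
     (\<forall>t\<in>space (agents E). info E t \<in> partn E ` {1..npart E}) \<and>
     (\<forall>i\<in>{1..npart E}. members_with E (space (agents E)) i \<in> sets (agents E)) \<and>
     (\<forall>t\<in>space (agents E). \<forall>\<omega>\<in>space (states E). endow E t \<omega> \<in> orthant) \<and>
     (\<forall>t\<in>space (agents E). prob_space (prior E t) \<and> sets (prior E t) = sets (states E))"


section \<open>Assumptions\<close>

definition assumption_A1' :: "('w, 't, 'l::finite) economy_data \<Rightarrow> bool" where
  "assumption_A1' E \<longleftrightarrow>
     (\<lambda>(t, \<omega>). endow E t \<omega>) \<in> borel_measurable (agents E \<Otimes>\<^sub>M states E) \<and>
     (\<forall>\<omega>\<in>space (states E).
        integrable (agents E) (\<lambda>t. endow E t \<omega>) \<and>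
        (AE t in agents E. strictly_positive (endow E t \<omega>)))"

definition assumption_A2 :: "('w, 't, 'l::finite) economy_data \<Rightarrow> bool" where
  "assumption_A2 E \<longleftrightarrow>
     (\<forall>x\<in>orthant. (\<lambda>(t, \<omega>). util E t \<omega> x) \<in> borel_measurable (agents E \<Otimes>\<^sub>M states E))"

definition assumption_A3 :: "('w, 't, 'l::finite) economy_data \<Rightarrow> bool" where
  "assumption_A3 E \<longleftrightarrow>
     (\<forall>t\<in>space (agents E). \<forall>\<omega>\<in>space (states E).
        continuous_on orthant (util E t \<omega>) \<and> strict_mono_on orthant (util E t \<omega>))"

definition assumption_A4' :: "('w, 't, 'l::finite) economy_data \<Rightarrow> bool" where
  "assumption_A4' E \<longleftrightarrow>
     (\<forall>t\<in>large_part E. \<forall>\<omega>\<in>space (states E). quasi_concave_on orthant (util E t \<omega>))"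

definition assumption_A5 :: "('w, 't, 'l::finite) economy_data \<Rightarrow> bool" where
  "assumption_A5 E \<longleftrightarrow>
     (\<forall>i\<in>{1..npart E}. emeasure (agents E) (members_with E (space (agents E)) i) > 0) \<and>
     space (agents E) = (\<Union>i\<in>{1..npart E}. members_with E (space (agents E)) i) \<and>
     join E {1..npart E} = sets (states E)"

definition assumption_A6 :: "('w, 't, 'l::finite) economy_data \<Rightarrow> bool" where
  "assumption_A6 E \<longleftrightarrow> (\<forall>s\<in>large_part E. \<forall>t\<in>large_part E. same_characteristics E s t)"


section \<open>Allocations and the ex-post core\<close>

definition assignment ::
    "('w, 't, 'l::finite) economy_data \<Rightarrow> ('t \<Rightarrow> 'w \<Rightarrow> real ^ 'l) \<Rightarrow> bool" where
  "assignment E f \<longleftrightarrow>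
     (\<forall>t\<in>space (agents E). \<forall>\<omega>\<in>space (states E). f t \<omega> \<in> orthant) \<and>
     (\<forall>\<omega>\<in>space (states E). integrable (agents E) (\<lambda>t. f t \<omega>)) \<and>
     (\<forall>t\<in>space (agents E). f t \<in> borel_measurable (states E))"

definition allocation ::
    "('w, 't, 'l::finite) economy_data \<Rightarrow> ('t \<Rightarrow> 'w \<Rightarrow> real ^ 'l) \<Rightarrow> bool" where
  "allocation E f \<longleftrightarrow> assignment E f \<and>
     (\<forall>\<omega>\<in>space (states E). (LINT t|agents E. f t \<omega>) = (LINT t|agents E. endow E t \<omega>))"

definition ex_post_blocked ::
    "('w, 't, 'l::finite) economy_data \<Rightarrow> ('t \<Rightarrow> 'w \<Rightarrow> real ^ 'l) \<Rightarrow> 't set \<Rightarrow> bool" where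
  "ex_post_blocked E f S \<longleftrightarrow>
     (\<exists>\<omega>\<^sub>0\<in>space (states E). \<exists>g. assignment E g \<and>
        (LINT t:S|agents E. g t \<omega>\<^sub>0) = (LINT t:S|agents E. endow E t \<omega>\<^sub>0) \<and>
        (AE t in agents E. t \<in> S \<longrightarrow>
           util E t \<omega>\<^sub>0 (g t \<omega>\<^sub>0) > util E t \<omega>\<^sub>0 (f t \<omega>\<^sub>0)))"

definition ex_post_core ::
    "('w, 't, 'l::finite) economy_data \<Rightarrow> ('t \<Rightarrow> 'w \<Rightarrow> real ^ 'l) set" where
  "ex_post_core E = {f. allocation E f \<and> \<not> (\<exists>S. coalition E S \<and> ex_post_blocked E f S)}"


section \<open>Conditional expectations and the fine core\<close>

text \<open>
  Fine blocking evaluates conditional expectations at individual states, whereas a conditional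
  expectation is only determined up to null sets. We therefore work with an arbitrary choice
  \<open>CE t \<G> X\<close> of versions of the conditional expectation of \<open>X\<close> given \<open>\<G>\<close> under the prior of
  agent \<open>t\<close>, subject to the convention that a \<open>\<G>\<close>-measurable function is its own conditional
  expectation. A function that is neither \<open>\<G>\<close>-measurable nor integrable has no conditional
  expectation, and \<open>CE\<close> is unconstrained there.
\<close>

definition cond_exp_versions ::
    "('w, 't, 'l::finite) economy_data \<Rightarrow>
     ('t \<Rightarrow> 'w set set \<Rightarrow> ('w \<Rightarrow> real) \<Rightarrow> 'w \<Rightarrow> real) \<Rightarrow> bool" where
  "cond_exp_versions E CE \<longleftrightarrow>
     (\<forall>t\<in>space (agents E). \<forall>\<G> X.
        sigma_algebra (space (states E)) \<G> \<and> \<G> \<subseteq> sets (states E) \<longrightarrow>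
          (X \<in> borel_measurable (sigma (space (states E)) \<G>) \<longrightarrow>
             (\<forall>\<omega>\<in>space (states E). CE t \<G> X \<omega> = X \<omega>)) \<and>
          (integrable (prior E t) X \<longrightarrow>
             CE t \<G> X \<in> borel_measurable (sigma (space (states E)) \<G>) \<and>
             (AE \<omega> in prior E t.
                CE t \<G> X \<omega> = real_cond_exp (prior E t) (sigma (space (states E)) \<G>) X \<omega>)))"

text \<open>Such a choice exists.\<close>

lemma cond_exp_versions_exist:
  assumes "mixed_economy E"
  shows "cond_exp_versions E (\<lambda>t \<G> X.
           if X \<in> borel_measurable (sigma (space (states E)) \<G>) then X
           else real_cond_exp (prior E t) (sigma (space (states E)) \<G>) X)"
proof -
  have "AE \<omega> in prior E t. X \<omega> = real_cond_exp (prior E t) (sigma (space (states E)) \<G>) X \<omega>"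
    if t: "t \<in> space (agents E)" and \<G>: "sigma_algebra (space (states E)) \<G>" "\<G> \<subseteq> sets (states E)"
      and X: "X \<in> borel_measurable (sigma (space (states E)) \<G>)" "integrable (prior E t) X"
    for t \<G> X
  proof -
    have p: "prob_space (prior E t)" "sets (prior E t) = sets (states E)"
      using assms t by (auto simp: mixed_economy_def)
    have sp: "space (prior E t) = space (states E)"
      using p(2) by (rule sets_eq_imp_space_eq)
    have "subalgebra (prior E t) (sigma (space (states E)) \<G>)"
      using \<G> p(2) sp sigma_algebra.sets_measure_of_eq[OF \<G>(1)]
        sigma_algebra.space_measure_of_eq[OF \<G>(1)]
      by (auto simp: subalgebra_def)
    then have "finite_measure_subalgebra (prior E t) (sigma (space (states E)) \<G>)"
      using p(1) by (simp add: finite_measure_subalgebra_def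
          finite_measure_subalgebra_axioms_def prob_space_def)
    then interpret finite_measure_subalgebra "prior E t" "sigma (space (states E)) \<G>" .
    show ?thesis
      using real_cond_exp_F_meas[OF X(2) X(1)] by auto
  qed
  then show ?thesis
    by (auto simp: cond_exp_versions_def)
qed

definition information_structure ::
    "('w, 't, 'l::finite) economy_data \<Rightarrow> 't set \<Rightarrow> ('t \<Rightarrow> 'w set set) \<Rightarrow> bool" where
  "information_structure E S G \<longleftrightarrow>
     (\<forall>t\<in>S. sigma_algebra (space (states E)) (G t) \<and> G t \<subseteq> sets (states E)) \<and>
     (\<forall>\<G>. sigma_algebra (space (states E)) \<G> \<and> \<G> \<subseteq> sets (states E) \<longrightarrow>
        {t \<in> S. G t = \<G>} \<in> sets (agents E))"

definition communication_system ::
    "('w, 't, 'l::finite) economy_data \<Rightarrow> 't set \<Rightarrow> ('t \<Rightarrow> 'w set set) \<Rightarrow> bool" where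
  "communication_system E S G \<longleftrightarrow> information_structure E S G \<and>
     (AE t in agents E. t \<in> S \<longrightarrow>
        info_algebra E t \<subseteq> G t \<and> G t \<subseteq> join E (active_parts E S))"

definition fine_blocked ::
    "('w, 't, 'l::finite) economy_data \<Rightarrow>
     ('t \<Rightarrow> 'w set set \<Rightarrow> ('w \<Rightarrow> real) \<Rightarrow> 'w \<Rightarrow> real) \<Rightarrow>
     ('t \<Rightarrow> 'w \<Rightarrow> real ^ 'l) \<Rightarrow> 't set \<Rightarrow> bool" where
  "fine_blocked E CE f S \<longleftrightarrow>
     (\<exists>g G \<Omega>\<^sub>0. allocation E g \<and> communication_system E S G \<and>
        \<Omega>\<^sub>0 \<noteq> {} \<and> (\<forall>t\<in>S. \<Omega>\<^sub>0 \<in> G t) \<and>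
        (\<forall>\<omega>\<in>\<Omega>\<^sub>0.
           (LINT t:S|agents E. g t \<omega>) = (LINT t:S|agents E. endow E t \<omega>) \<and>
           (AE t in agents E. t \<in> S \<longrightarrow>
              CE t (G t) (\<lambda>\<omega>'. util E t \<omega>' (g t \<omega>')) \<omega> >
              CE t (G t) (\<lambda>\<omega>'. util E t \<omega>' (f t \<omega>')) \<omega>)))"

definition fine_core ::
    "('w, 't, 'l::finite) economy_data \<Rightarrow>
     ('t \<Rightarrow> 'w set set \<Rightarrow> ('w \<Rightarrow> real) \<Rightarrow> 'w \<Rightarrow> real) \<Rightarrow>
     ('t \<Rightarrow> 'w \<Rightarrow> real ^ 'l) set" where
  "fine_core E CE = {f. allocation E f \<and> \<not> (\<exists>S. coalition E S \<and> fine_blocked E CE f S)}"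

end

theory Submission
  imports Defs
begin

text \<open>
  Fix a state in which \<open>f\<close> is ex-post blocked by \<open>S\<close>. If \<open>S\<close> can be replaced by a blocking coalition
  that contains every information type in positive measure, then its members can pool their
  information into all of \<open>\<F>\<close>; everything measurable is constant on the block of the common refinement
  that contains the state, so blocking there is fine blocking.

  Shrinking the blocking bundles slightly leaves a surplus of every good, which pays for
  sufficiently small groups of small agents of the missing types, who keep \<open>f\<close>. Only a type consisting
  of large agents alone cannot be reached in this way. In that case let \<open>S\<close> consist of small agents, let
  \<open>A\<close> be a large agent that does not prefer its bundle to the mean bundle of all large agents plus a
  little extra, and let \<open>r < 1\<close> be its share of the measure of the large agents. An approximate form of
  Lyapunov's theorem yields a set \<open>D\<close> of small agents on which the integrals are \<open>r\<close> times those
  over all small agents. Now \<open>D\<close> keeps \<open>f\<close>, the members of \<open>S - D\<close> keep their blocking bundles, and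
  \<open>A\<close> gets the mean bundle plus a little extra. As \<open>f\<close> is feasible, the net demand is about
  \<open>1 - r\<close> times that of \<open>S\<close>, hence still leaves a surplus.
\<close>

section \<open>Atomless measures and an approximate Lyapunov theorem\<close>

text \<open>The notion is relative to a set so that it passes to every measurable subset; this is
  what lets splitting be iterated inside \<open>N\<close>.\<close>

definition atomless_on :: "'a measure \<Rightarrow> 'a set \<Rightarrow> bool" where
  "atomless_on M N \<longleftrightarrow> N \<in> sets M \<and> (\<forall>A\<subseteq>N. \<not> measure_atom M A)"

lemma atomless_on_subset: "atomless_on M N \<Longrightarrow> B \<in> sets M \<Longrightarrow> B \<subseteq> N \<Longrightarrow> atomless_on M B"
  by (auto simp: atomless_on_def)

context finite_measure
begin

text \<open>Not being an atom, \<open>N\<close> splits into two parts of positive measure, and the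
  smaller one has at most half of the total.\<close>

lemma atomless_halving:
  assumes N: "atomless_on M N" "0 < measure M N"
  obtains B where "B \<in> sets M" "B \<subseteq> N" "0 < measure M B" "measure M B \<le> measure M N / 2"
proof -
  have "N \<in> sets M" "\<not> measure_atom M N"
    using N by (auto simp: atomless_on_def)
  then obtain B where B: "B \<in> sets M" "B \<subseteq> N" "emeasure M B \<noteq> 0" "emeasure M (N - B) \<noteq> 0"
    using N(2) by (auto simp: measure_atom_def emeasure_eq_measure)
  then have pos: "0 < measure M B" "0 < measure M (N - B)"
    by (auto simp: emeasure_eq_measure zero_less_measure_iff)
  have sum: "measure M N = measure M B + measure M (N - B)"
    using \<open>N \<in> sets M\<close> B finite_measure_Diff[of N B] by simp
  show ?thesis
  proof (cases "measure M B \<le> measure M (N - B)")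
    case True
    then show ?thesis
      using that[of B] B pos sum by auto
  next
    case False
    then show ?thesis
      using that[of "N - B"] B pos sum \<open>N \<in> sets M\<close> by auto
  qed
qed

text \<open>Repeated halving keeps the measure positive while bounding it by a geometric
  sequence.\<close>

lemma atomless_small_subset:
  assumes N: "atomless_on M N" "0 < measure M N" and "0 < e"
  obtains B where "B \<in> sets M" "B \<subseteq> N" "0 < measure M B" "measure M B \<le> e"
proof -
  have *: "\<exists>B\<in>sets M. B \<subseteq> N \<and> 0 < measure M B \<and> measure M B \<le> measure M N / 2 ^ n" for n
  proof (induction n)
    case 0
    then show ?case
      using N by (auto simp: atomless_on_def intro!: bexI[of _ N])
  next
    case (Suc n)
    then obtain B where B: "B \<in> sets M" "B \<subseteq> N" "0 < measure M B" "measure M B \<le> measure M N / 2 ^ n"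
      by blast
    obtain C where C: "C \<in> sets M" "C \<subseteq> B" "0 < measure M C" "measure M C \<le> measure M B / 2"
      using atomless_halving[OF atomless_on_subset[OF N(1) B(1,2)] B(3)] by blast
    have "measure M C \<le> measure M N / 2 ^ Suc n"
      using C(4) B(4) by simp
    with B(2) C show ?case
      by blast
  qed
  obtain n where "measure M N / e < 2 ^ n"
    using real_arch_pow[of 2 "measure M N / e"] by auto
  then have "measure M N / 2 ^ n \<le> e"
    using \<open>0 < e\<close> by (simp add: field_simps)
  with * [of n] show ?thesis
    using that by force
qed

text \<open>Sierpinski's theorem, by exhaustion: each step adds a set of at least half the largest
  measure that still fits.\<close>

lemma atomless_subset_of_measure:
  assumes N: "atomless_on M N" and c: "0 \<le> c" "c \<le> measure M N"
  obtains D where "D \<in> sets M" "D \<subseteq> N" "measure M D = c"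
proof -
  define fits where "fits D = {E \<in> sets M. E \<subseteq> N - D \<and> measure M D + measure M E \<le> c}" for D
  have Nm: "N \<in> sets M"
    using N by (simp add: atomless_on_def)
  have "\<exists>E\<in>fits D. \<forall>E'\<in>fits D. measure M E' \<le> 2 * measure M E"
    if D: "D \<in> sets M" "measure M D \<le> c" for D
  proof -
    have ne: "{} \<in> fits D"
      using D by (simp add: fits_def)
    have bdd: "bdd_above (measure M ` fits D)"
      by (rule bdd_aboveI[of _ "measure M (space M)"]) (auto intro: bounded_measure)
    let ?s = "SUP E\<in>fits D. measure M E"
    have upper: "measure M E \<le> ?s" if "E \<in> fits D" for E
      using bdd that by (rule cSUP_upper2) simp
    show ?thesis
    \<comment> \<open>A positive supremum is less than twice the measure of some fitting set;
      otherwise all fitting sets are null and the empty set serves.\<close>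
    proof (cases "0 < ?s")
      case True
      then have "?s / 2 < ?s" by simp
      then obtain E where "E \<in> fits D" "?s / 2 < measure M E"
        using less_cSUP_iff[of "fits D" "measure M" "?s / 2"] bdd ne by blast
      with upper show ?thesis
        by (intro bexI[of _ E]) (auto, smt (verit) field_sum_of_halves)
    next
      case False
      then show ?thesis
        using upper ne by (intro bexI[of _ "{}"]) (auto, smt (verit))
    qed
  qed
  then obtain add where add: "\<And>D. D \<in> sets M \<Longrightarrow> measure M D \<le> c \<Longrightarrow> add D \<in> fits D"
    "\<And>D E. D \<in> sets M \<Longrightarrow> measure M D \<le> c \<Longrightarrow> E \<in> fits D \<Longrightarrow> measure M E \<le> 2 * measure M (add D)"
    by metis
  define D where "D = rec_nat {} (\<lambda>_ D. D \<union> add D)"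
  have D0: "D 0 = {}" and DS: "D (Suc n) = D n \<union> add (D n)" for n
    by (simp_all add: D_def)
  have D: "D n \<in> sets M \<and> D n \<subseteq> N \<and> measure M (D n) \<le> c" for n
  proof (induction n)
    case 0
    then show ?case
      using c by (simp add: D0)
  next
    case (Suc n)
    then have a: "add (D n) \<in> fits (D n)"
      by (intro add) auto
    with Suc have "measure M (D (Suc n)) = measure M (D n) + measure M (add (D n))"
      unfolding DS by (intro finite_measure_Union) (auto simp: fits_def)
    with a Suc show ?case
      by (auto simp: DS fits_def)
  qed
  have step: "measure M (D (Suc n)) = measure M (D n) + measure M (add (D n))" for n
    unfolding DS using D[of n] add(1)[of "D n"] by (intro finite_measure_Union) (auto simp: fits_def)
  let ?U = "\<Union>n. D n"
  have U: "?U \<in> sets M" "?U \<subseteq> N"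
    using D by auto
  have inc: "incseq D"
    by (rule incseq_SucI) (auto simp: DS)
  have lim: "(\<lambda>n. measure M (D n)) \<longlonglongrightarrow> measure M ?U"
    using D inc by (intro finite_Lim_measure_incseq) auto
  then have Uc: "measure M ?U \<le> c"
    using D by (intro LIMSEQ_le_const2[OF lim]) auto
  have "measure M ?U = c"
  proof (rule ccontr)
    assume "measure M ?U \<noteq> c"
    with Uc have less: "0 < c - measure M ?U" by simp
    have "measure M (N - ?U) = measure M N - measure M ?U"
      using U Nm by (intro finite_measure_Diff) auto
    then have "0 < measure M (N - ?U)"
      using less c by simp
    moreover have "atomless_on M (N - ?U)"
      by (rule atomless_on_subset[OF N]) (use U Nm in auto)
    ultimately obtain B where B: "B \<in> sets M" "B \<subseteq> N - ?U" "0 < measure M B"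
        "measure M B \<le> c - measure M ?U"
      using atomless_small_subset less by metis
    \<comment> \<open>The leftover set \<open>B\<close> would have fitted at every stage, so each
      increment is at least half its measure; but the increments of a convergent sequence tend to
      0.\<close>
    have "measure M B / 2 \<le> measure M (add (D n))" for n
    proof -
      have "measure M (D n) \<le> measure M ?U"
        using U D by (intro finite_measure_mono) auto
      then have "B \<in> fits (D n)"
        using B by (auto simp: fits_def)
      then show ?thesis
        using add(2)[of "D n" B] D[of n] by simp
    qed
    moreover have "(\<lambda>n. measure M (D (Suc n)) - measure M (D n)) \<longlonglongrightarrow> measure M ?U - measure M ?U"
      by (intro tendsto_diff lim LIMSEQ_Suc)
    then have "(\<lambda>n. measure M (add (D n))) \<longlonglongrightarrow> 0"
      by (simp add: step)
    ultimately have "measure M B / 2 \<le> 0"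
      by (intro LIMSEQ_le_const[of "\<lambda>n. measure M (add (D n))"]) auto
    with B(3) show False by simp
  qed
  with U that show ?thesis by blast
qed

section \<open>Subsets taking the same share of finitely many sets, and of integrals\<close>

text \<open>Induction on the family: the new set \<open>A\<close> cuts \<open>N\<close> in two, and
  the union of proportional subsets of both pieces is proportional for the old sets as well as for
  \<open>A\<close>.\<close>

lemma atomless_proportional_subset:
  assumes "finite \<A>" "\<A> \<subseteq> sets M" and N: "atomless_on M N" and r: "0 \<le> r" "r \<le> 1"
  shows "\<exists>D\<in>sets M. D \<subseteq> N \<and> measure M D = r * measure M N \<and>
    (\<forall>A\<in>\<A>. measure M (D \<inter> A) = r * measure M (N \<inter> A))"
  using assms(1,2) N
proof (induction \<A> arbitrary: N)
  case empty
  obtain D where "D \<in> sets M" "D \<subseteq> N" "measure M D = r * measure M N"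
    using atomless_subset_of_measure[OF empty(2), of "r * measure M N"] r
    by (auto simp: mult_left_le_one_le)
  then show ?case by blast
next
  case (insert A \<A>)
  have Nm [measurable]: "N \<in> sets M" and Am [measurable]: "A \<in> sets M"
    using insert.prems by (auto simp: atomless_on_def)
  have "atomless_on M (N \<inter> A)" "atomless_on M (N - A)"
    by (auto intro: atomless_on_subset[OF insert.prems(2)])
  with insert obtain D1 D2 where
    D1: "D1 \<in> sets M" "D1 \<subseteq> N \<inter> A" "measure M D1 = r * measure M (N \<inter> A)"
      "\<And>B. B \<in> \<A> \<Longrightarrow> measure M (D1 \<inter> B) = r * measure M (N \<inter> A \<inter> B)" and
    D2: "D2 \<in> sets M" "D2 \<subseteq> N - A" "measure M D2 = r * measure M (N - A)"
      "\<And>B. B \<in> \<A> \<Longrightarrow> measure M (D2 \<inter> B) = r * measure M ((N - A) \<inter> B)"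
    by (metis insert_subset)
  have split: "measure M (C1 \<union> C2) = measure M C1 + measure M C2"
    if "C1 \<in> sets M" "C2 \<in> sets M" "C1 \<subseteq> A" "C2 \<inter> A = {}" for C1 C2
    using that by (intro finite_measure_Union) auto
  have "measure M (D1 \<union> D2) = r * measure M N"
    using split[of D1 D2] split[of "N \<inter> A" "N - A"] D1 D2
    by (auto simp: Int_Diff_Un Diff_Int_distrib2 distrib_left)
  \<comment> \<open>Here the clause on the total measure of \<open>D\<close>, carried through the
    induction, is applied to the piece \<open>N \<inter> A\<close>.\<close>
  moreover have "measure M ((D1 \<union> D2) \<inter> A) = r * measure M (N \<inter> A)"
  proof -
    have "(D1 \<union> D2) \<inter> A = D1" using D1(2) D2(2) by blast
    then show ?thesis using D1 by simp
  qed
  moreover have "measure M ((D1 \<union> D2) \<inter> B) = r * measure M (N \<inter> B)" if B: "B \<in> \<A>" for B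
  proof -
    have [measurable]: "B \<in> sets M" using B insert.prems by auto
    have "measure M ((D1 \<inter> B) \<union> (D2 \<inter> B)) = measure M (D1 \<inter> B) + measure M (D2 \<inter> B)"
      using D1(1,2) D2(1,2) by (intro split) auto
    moreover have "measure M ((N \<inter> A \<inter> B) \<union> ((N - A) \<inter> B))
        = measure M (N \<inter> A \<inter> B) + measure M ((N - A) \<inter> B)"
      by (intro split) auto
    moreover have "(N \<inter> A \<inter> B) \<union> ((N - A) \<inter> B) = N \<inter> B" "(D1 \<inter> B) \<union> (D2 \<inter> B) = (D1 \<union> D2) \<inter> B"
      by auto
    ultimately show ?thesis
      using D1(4)[OF B] D2(4)[OF B] by (simp add: distrib_left)
  qed
  ultimately show ?case
    using D1 D2 by (intro bexI[of _ "D1 \<union> D2"]) auto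
qed

text \<open>Integrals are controlled through a finite family of test sets that is fixed before
  \<open>D\<close>. In this form the claim survives sums, by uniting the families, and limits in
  mean, by using the family of a close approximant.\<close>

lemma proportional_integral_approx:
  fixes h :: "'a \<Rightarrow> 'b::{banach, second_countable_topology}"
  assumes "integrable M h" and N [measurable]: "N \<in> sets M" and "0 < e" and r: "0 \<le> r" "r \<le> 1"
  shows "\<exists>\<A>. finite \<A> \<and> \<A> \<subseteq> sets M \<and> (\<forall>D\<in>sets M. D \<subseteq> N \<longrightarrow>
    (\<forall>A\<in>\<A>. measure M (D \<inter> A) = r * measure M (N \<inter> A)) \<longrightarrow>
    norm ((LINT x:D|M. h x) - r *\<^sub>R (LINT x:N|M. h x)) \<le> e)"
  using assms(1,3)
proof (induction h arbitrary: e)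
  case (base A c)
  \<comment> \<open>For an indicator the integral is determined by the measure of
    \<open>D \<inter> A\<close>, so the test set \<open>A\<close> alone gives error zero.\<close>
  have "(LINT x:D|M. indicator A x *\<^sub>R c) = measure M (D \<inter> A) *\<^sub>R c" if "D \<in> sets M" for D
  proof -
    have "(LINT x:D|M. indicator A x *\<^sub>R c) = (LINT x|M. indicator (D \<inter> A) x *\<^sub>R c)"
      unfolding set_lebesgue_integral_def
      by (intro Bochner_Integration.integral_cong) (auto split: split_indicator)
    with base(1) that show ?thesis
      by (simp add: emeasure_eq_measure)
  qed
  then show ?case
    using base by (intro exI[of _ "{A}"]) (auto simp: less_imp_le)
next
  case (add f g)
  have "0 < e / 2" using add.prems by simp
  from add.IH(1)[OF this] add.IH(2)[OF this] obtain \<A> \<B> where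
    AB: "finite \<A>" "\<A> \<subseteq> sets M" "finite \<B>" "\<B> \<subseteq> sets M" and
    A: "\<And>D. D \<in> sets M \<Longrightarrow> D \<subseteq> N \<Longrightarrow> (\<forall>A\<in>\<A>. measure M (D \<inter> A) = r * measure M (N \<inter> A)) \<Longrightarrow>
       norm ((LINT x:D|M. f x) - r *\<^sub>R (LINT x:N|M. f x)) \<le> e / 2" and
    B: "\<And>D. D \<in> sets M \<Longrightarrow> D \<subseteq> N \<Longrightarrow> (\<forall>A\<in>\<B>. measure M (D \<inter> A) = r * measure M (N \<inter> A)) \<Longrightarrow>
       norm ((LINT x:D|M. g x) - r *\<^sub>R (LINT x:N|M. g x)) \<le> e / 2"
    by auto
  show ?case
  proof (intro exI[of _ "\<A> \<union> \<B>"] conjI ballI impI)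
    fix D assume D: "D \<in> sets M" "D \<subseteq> N" "\<forall>A\<in>\<A> \<union> \<B>. measure M (D \<inter> A) = r * measure M (N \<inter> A)"
    have int: "(LINT x:C|M. f x + g x) = (LINT x:C|M. f x) + (LINT x:C|M. g x)" if "C \<in> sets M" for C
      using add.hyps that by (intro set_integral_add) (auto simp: set_integrable_def intro: integrable_mult_indicator)
    have "norm ((LINT x:D|M. f x + g x) - r *\<^sub>R (LINT x:N|M. f x + g x)) =
      norm (((LINT x:D|M. f x) - r *\<^sub>R (LINT x:N|M. f x)) + ((LINT x:D|M. g x) - r *\<^sub>R (LINT x:N|M. g x)))"
      using D by (simp add: int algebra_simps)
    also have "\<dots> \<le> e / 2 + e / 2"
      using D by (intro norm_triangle_mono A B) auto
    finally show "norm ((LINT x:D|M. f x + g x) - r *\<^sub>R (LINT x:N|M. f x + g x)) \<le> e" by simp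
  qed (use AB in auto)
next
  case (lim f s)
  note [measurable] = borel_measurable_integrable[OF lim.hyps(1)] borel_measurable_integrable[OF lim.hyps(4)]
  have "(\<lambda>i. LINT x|M. norm (s i x - f x)) \<longlonglongrightarrow> (LINT x|M. 0)"
  \<comment> \<open>The approximants of the induction rule are bounded by twice
    \<open>norm (f x)\<close>, hence the differences by three times.\<close>
  proof (rule integral_dominated_convergence[where w = "\<lambda>x. 3 * norm (f x)"])
    show "AE x in M. (\<lambda>i. norm (s i x - f x)) \<longlonglongrightarrow> 0"
      using lim.hyps(2) by (intro AE_I2) (auto intro!: tendsto_norm_zero simp: LIM_zero_iff)
    show "AE x in M. norm (norm (s i x - f x)) \<le> 3 * norm (f x)" for i
    proof (rule AE_I2)
      fix x assume "x \<in> space M"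
      then show "norm (norm (s i x - f x)) \<le> 3 * norm (f x)"
        using norm_triangle_ineq4[of "s i x" "f x"] lim.hyps(3)[of x i] by simp
    qed
  qed (use lim.hyps in auto)
  then have "\<forall>\<^sub>F i in sequentially. (LINT x|M. norm (s i x - f x)) < e / 3"
    using lim.prems by (intro order_tendstoD(2)) auto
  then obtain i where i: "(LINT x|M. norm (s i x - f x)) < e / 3"
    by (auto dest: eventually_happens)
  have close: "norm ((LINT x:C|M. s i x) - (LINT x:C|M. f x)) \<le> e / 3" if C: "C \<in> sets M" for C
  proof -
    have ints: "set_integrable M C (s i)" "set_integrable M C f"
      using lim.hyps C by (auto simp: set_integrable_def intro: integrable_mult_indicator)
    have "norm ((LINT x:C|M. s i x) - (LINT x:C|M. f x)) = norm (LINT x:C|M. s i x - f x)"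
      using ints by simp
    also have "\<dots> \<le> (LINT x|M. norm (s i x - f x))"
      unfolding set_lebesgue_integral_def
    proof (intro order_trans[OF integral_norm_bound integral_mono] integrable_norm)
      show "integrable M (\<lambda>x. indicator C x *\<^sub>R (s i x - f x))"
        using lim.hyps C by (intro integrable_mult_indicator) auto
    qed (use lim.hyps in \<open>auto split: split_indicator\<close>)
    finally show ?thesis using i by simp
  qed
  have "0 < e / 3" using lim.prems by simp
  from lim.IH[OF this, of i] obtain \<A> where
    A: "finite \<A>" "\<A> \<subseteq> sets M" 
       "\<And>D. D \<in> sets M \<Longrightarrow> D \<subseteq> N \<Longrightarrow> (\<forall>A\<in>\<A>. measure M (D \<inter> A) = r * measure M (N \<inter> A)) \<Longrightarrow>
       norm ((LINT x:D|M. s i x) - r *\<^sub>R (LINT x:N|M. s i x)) \<le> e / 3"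
    by auto
  show ?case
  proof (intro exI[of _ \<A>] conjI ballI impI A(1,2))
    fix D assume D: "D \<in> sets M" "D \<subseteq> N" "\<forall>A\<in>\<A>. measure M (D \<inter> A) = r * measure M (N \<inter> A)"
    have "norm (r *\<^sub>R (LINT x:N|M. s i x) - r *\<^sub>R (LINT x:N|M. f x))
        = r * norm ((LINT x:N|M. s i x) - (LINT x:N|M. f x))"
      using r by (simp flip: scaleR_diff_right)
    also have "\<dots> \<le> 1 * (e / 3)"
      using r close[OF N] by (intro mult_mono) auto
    finally have "norm (r *\<^sub>R (LINT x:N|M. s i x) - r *\<^sub>R (LINT x:N|M. f x)) \<le> e / 3"
      by simp
    with close[OF D(1)] A(3)[OF D] 
    have "dist (LINT x:D|M. f x) (LINT x:D|M. s i x) \<le> e / 3"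
      "dist (LINT x:D|M. s i x) (r *\<^sub>R (LINT x:N|M. s i x)) \<le> e / 3"
      "dist (r *\<^sub>R (LINT x:N|M. s i x)) (r *\<^sub>R (LINT x:N|M. f x)) \<le> e / 3"
      by (simp_all add: dist_norm norm_minus_commute)
    then have "dist (LINT x:D|M. f x) (r *\<^sub>R (LINT x:N|M. f x)) \<le> e"
      by metric
    then show "norm ((LINT x:D|M. f x) - r *\<^sub>R (LINT x:N|M. f x)) \<le> e"
      by (simp add: dist_norm)
  qed
qed

text \<open>An approximation is enough later on, because strict positivity of a surplus is an open
  condition. One \<open>D\<close> serves all coordinates of a vector-valued
  \<open>h\<close>.\<close>

lemma atomless_approximate_Lyapunov:
  fixes h :: "'a \<Rightarrow> 'b::{banach, second_countable_topology}"
  assumes "integrable M h" and N: "atomless_on M N" and "0 < e" and r: "0 \<le> r" "r \<le> 1"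
  obtains D where "D \<in> sets M" "D \<subseteq> N"
    "norm ((LINT x:D|M. h x) - r *\<^sub>R (LINT x:N|M. h x)) \<le> e"
proof -
  have "N \<in> sets M" using N by (simp add: atomless_on_def)
  from proportional_integral_approx[OF assms(1) this assms(3) r] obtain \<A> where
    A: "finite \<A>" "\<A> \<subseteq> sets M"
      "\<And>D. D \<in> sets M \<Longrightarrow> D \<subseteq> N \<Longrightarrow> (\<forall>A\<in>\<A>. measure M (D \<inter> A) = r * measure M (N \<inter> A)) \<Longrightarrow>
       norm ((LINT x:D|M. h x) - r *\<^sub>R (LINT x:N|M. h x)) \<le> e"
    by auto
  from atomless_proportional_subset[OF A(1,2) N r] A(3) that show ?thesis
    by blast
qed

end

section \<open>Orthant-valued functions\<close>

lemma set_integral_vec_nth: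
  fixes h :: "'a \<Rightarrow> real ^ 'l::finite"
  assumes "set_integrable M A h"
  shows "(LINT t:A|M. h t) $ k = (LINT t:A|M. h t $ k)"
  using integral_bounded_linear[OF bounded_linear_vec_nth assms[unfolded set_integrable_def], of k]
  by (simp add: set_lebesgue_integral_def)

lemma integrable_imp_set_integrable:
  fixes h :: "'a \<Rightarrow> 'b::{banach, second_countable_topology}"
  shows "integrable M h \<Longrightarrow> A \<in> sets M \<Longrightarrow> set_integrable M A h"
  by (simp add: set_integrable_def integrable_mult_indicator)

lemma integrable_If_set:
  fixes y z :: "'a \<Rightarrow> 'b::{banach, second_countable_topology}"
  assumes y: "integrable M y" and z: "integrable M z" and [measurable]: "A \<in> sets M"
  shows "integrable M (\<lambda>t. if t \<in> A then y t else z t)"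
proof (rule Bochner_Integration.integrable_bound)
  show "integrable M (\<lambda>t. norm (y t) + norm (z t))"
    using y z by auto
  show "(\<lambda>t. if t \<in> A then y t else z t) \<in> borel_measurable M"
    using borel_measurable_integrable[OF y] borel_measurable_integrable[OF z] by measurable
qed auto

lemma closed_orthant: "closed (orthant :: (real ^ 'l::finite) set)"
  unfolding orthant_def less_eq_vec_def by (intro closed_Collect_all closed_Collect_le continuous_intros)

lemma convex_orthant: "convex (orthant :: (real ^ 'l::finite) set)"
  by (auto simp: convex_def orthant_def less_eq_vec_def)

lemma orthant_add: "x \<in> orthant \<Longrightarrow> y \<in> orthant \<Longrightarrow> x + y \<in> (orthant :: (real ^ 'l::finite) set)"
  by (auto simp: orthant_def less_eq_vec_def)

lemma orthant_scaleR: "0 \<le> r \<Longrightarrow> x \<in> orthant \<Longrightarrow> r *\<^sub>R x \<in> (orthant :: (real ^ 'l::finite) set)"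
  by (auto simp: orthant_def less_eq_vec_def)

lemma strictly_positive_orthant: "strictly_positive x \<Longrightarrow> x \<in> (orthant :: (real ^ 'l::finite) set)"
  by (auto simp: orthant_def less_eq_vec_def strictly_positive_def less_imp_le)

lemma strictly_positive_scaleR: "0 < r \<Longrightarrow> strictly_positive x \<Longrightarrow> strictly_positive (r *\<^sub>R x)"
  by (simp add: strictly_positive_def)

lemma strictly_positive_neq_0: "strictly_positive x \<Longrightarrow> x \<noteq> (0 :: real ^ 'l::finite)"
  by (auto simp: strictly_positive_def)

lemma less_add_strictly_positive: "strictly_positive c \<Longrightarrow> x < x + (c :: real ^ 'l::finite)"
  by (simp add: less_vec_def less_eq_vec_def strictly_positive_def less_imp_le not_le)

text \<open>A finite intersection of open half-spaces is open. The radius \<open>e\<close> is the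
  error that a surplus tolerates.\<close>

lemma strictly_positive_nearby:
  fixes x :: "real ^ 'l::finite"
  assumes "strictly_positive x"
  obtains e where "0 < e" "\<And>z. norm (z - x) \<le> e \<Longrightarrow> strictly_positive z"
proof -
  have "open (\<Inter>k. {x :: real ^ 'l. 0 < x $ k})"
    by (intro open_INT ballI open_Collect_less continuous_intros finite)
  also have "(\<Inter>k. {x :: real ^ 'l. 0 < x $ k}) = {x. strictly_positive x}"
    by (auto simp: strictly_positive_def)
  finally have "open {x :: real ^ 'l. strictly_positive x}" .
  then obtain e where "0 < e" "cball x e \<subseteq> {x. strictly_positive x}"
    using assms unfolding open_contains_cball by blast
  with that[of e] show ?thesis
    by (auto simp: dist_norm norm_minus_commute subset_eq)
qed

text \<open>Rounding \<open>h\<close> down to a grid keeps it in the orthant and makes it countably valued.\<close>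

lemma caratheodory_measurable:
  fixes u :: "'a \<Rightarrow> real ^ 'l::finite \<Rightarrow> real"
  assumes u: "\<And>x. x \<in> orthant \<Longrightarrow> (\<lambda>t. u t x) \<in> borel_measurable M"
    and cont: "\<And>t. t \<in> space M \<Longrightarrow> continuous_on orthant (u t)"
    and h [measurable]: "h \<in> borel_measurable M"
    and orth: "\<And>t. t \<in> space M \<Longrightarrow> h t \<in> orthant"
  shows "(\<lambda>t. u t (h t)) \<in> borel_measurable M"
proof -
  define grid :: "nat \<Rightarrow> 'a \<Rightarrow> nat ^ 'l" where "grid n t = (\<chi> k. nat \<lfloor>real (Suc n) * h t $ k\<rfloor>)" for n t
  define pt :: "nat \<Rightarrow> nat ^ 'l \<Rightarrow> real ^ 'l" where "pt n v = (\<chi> k. real (v $ k) / real (Suc n))" for n v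
  have pt_orth: "pt n v \<in> orthant" for n v
    by (simp add: pt_def orthant_def less_eq_vec_def)
  have comp [measurable]: "(\<lambda>t. h t $ k) \<in> borel_measurable M" for k
    using measurable_compose[OF h borel_measurable_nth] .
  have grid: "grid n \<in> M \<rightarrow>\<^sub>M count_space UNIV" for n
  proof -
    have "grid n -` {v} \<inter> space M = {t \<in> space M. \<forall>k. nat \<lfloor>real (Suc n) * h t $ k\<rfloor> = v $ k}" for v
      by (auto simp: grid_def vec_eq_iff)
    moreover have "{t \<in> space M. \<forall>k. nat \<lfloor>real (Suc n) * h t $ k\<rfloor> = v $ k} \<in> sets M" for v
      by measurable
    ultimately show ?thesis
      by (simp add: measurable_count_space_eq2_countable)
  qed
  have "(\<lambda>t. u t (pt n (grid n t))) \<in> borel_measurable M" for n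
    by (rule measurable_compose_countable[where f = "\<lambda>v t. u t (pt n v)", OF u[OF pt_orth] grid])
  moreover have "(\<lambda>n. u t (pt n (grid n t))) \<longlonglongrightarrow> u t (h t)" if t: "t \<in> space M" for t
  proof (rule continuous_on_tendsto_compose[OF cont[OF t] _ orth[OF t]])
    show "(\<lambda>n. pt n (grid n t)) \<longlonglongrightarrow> h t"
    proof (rule vec_tendstoI)
      fix k
      have pos: "0 \<le> h t $ k"
        using orth[OF t] by (simp add: orthant_def less_eq_vec_def)
      \<comment> \<open>The conversion by \<open>nat\<close> loses nothing here, as the coordinates
        of \<open>h t\<close> are nonnegative.\<close>
      have eq: "pt n (grid n t) $ k = real_of_int \<lfloor>real (Suc n) * h t $ k\<rfloor> / real (Suc n)" for n
        using pos by (simp add: pt_def grid_def)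
      have "norm (pt n (grid n t) $ k - h t $ k) \<le> inverse (real (Suc n))" for n
      proof -
        have "\<bar>real_of_int \<lfloor>real (Suc n) * h t $ k\<rfloor> - real (Suc n) * h t $ k\<bar> \<le> 1"
          by linarith
        then have "\<bar>real_of_int \<lfloor>real (Suc n) * h t $ k\<rfloor> - real (Suc n) * h t $ k\<bar> / real (Suc n)
            \<le> 1 / real (Suc n)"
          by (intro divide_right_mono) auto
        also have "\<bar>real_of_int \<lfloor>real (Suc n) * h t $ k\<rfloor> - real (Suc n) * h t $ k\<bar> / real (Suc n)
          = \<bar>(real_of_int \<lfloor>real (Suc n) * h t $ k\<rfloor> - real (Suc n) * h t $ k) / real (Suc n)\<bar>"
          by (simp only: abs_divide abs_of_nat)
        finally show ?thesis
          by (simp add: eq diff_divide_distrib inverse_eq_divide del: of_nat_Suc)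
      qed
      then have "(\<lambda>n. pt n (grid n t) $ k - h t $ k) \<longlonglongrightarrow> 0"
        by (intro Lim_null_comparison[OF _ LIMSEQ_inverse_real_of_nat] always_eventually) auto
      then show "(\<lambda>n. pt n (grid n t) $ k) \<longlonglongrightarrow> h t $ k"
        by (simp add: LIM_zero_iff)
    qed
  qed (simp add: pt_orth)
  ultimately show ?thesis
    by (rule borel_measurable_LIMSEQ_real[rotated])
qed

text \<open>A mean outside \<open>C\<close> could be strictly separated from \<open>C\<close> by a
  hyperplane; integrating the separating inequality over \<open>A\<close> contradicts this.\<close>

lemma (in finite_measure) mean_in_closed_convex:
  fixes h :: "'a \<Rightarrow> 'b::euclidean_space"
  assumes C: "convex C" "closed C" and h: "integrable M h" and A: "A \<in> sets M" "0 < measure M A"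
    and AE: "AE t in M. t \<in> A \<longrightarrow> h t \<in> C"
  shows "(LINT t:A|M. h t) /\<^sub>R measure M A \<in> C"
proof (rule ccontr)
  let ?z = "(LINT t:A|M. h t) /\<^sub>R measure M A"
  assume "?z \<notin> C"
  then obtain v b where v: "v \<bullet> ?z < b" "\<And>x. x \<in> C \<Longrightarrow> b < v \<bullet> x"
    using separating_hyperplane_closed_point[OF C] by blast
  have hA: "set_integrable M A h"
    using h A by (simp add: integrable_imp_set_integrable)
  have vh: "integrable M (\<lambda>t. v \<bullet> h t)"
    using h by simp
  have "measure M A * b = (LINT t:A|M. b)"
    using A by (simp add: set_lebesgue_integral_def emeasure_eq_measure)
  also have "\<dots> \<le> (LINT t:A|M. v \<bullet> h t)"
  proof (rule set_integral_mono_AE)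
    show "set_integrable M A (\<lambda>_. b)" "set_integrable M A (\<lambda>t. v \<bullet> h t)"
      using A vh by (auto intro: integrable_imp_set_integrable)
    show "AE t\<in>A in M. b \<le> v \<bullet> h t"
      using AE by eventually_elim (auto dest: v(2) less_imp_le)
  qed
  also have "\<dots> = v \<bullet> (LINT t:A|M. h t)"
    using hA by (simp add: set_lebesgue_integral_def set_integrable_def flip: inner_scaleR_right)
  also have "\<dots> = measure M A * (v \<bullet> ?z)"
    using A by simp
  finally show False
    using v(1) A by simp
qed

section \<open>Blocking with a surplus\<close>

text \<open>The economy frozen at one state: \<open>u\<close>, \<open>a\<close> and \<open>f\<close>
  are the utilities, the endowments and the given allocation there. Coalitions are built at this
  level, and information enters only afterwards.\<close>

locale pure_exchange = finite_measure M for M :: "'t measure" +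
  fixes u :: "'t \<Rightarrow> real ^ 'l::finite \<Rightarrow> real" and a f :: "'t \<Rightarrow> real ^ 'l"
  assumes u_measurable: "x \<in> orthant \<Longrightarrow> (\<lambda>t. u t x) \<in> borel_measurable M"
    and u_continuous: "t \<in> space M \<Longrightarrow> continuous_on orthant (u t)"
    and u_mono: "t \<in> space M \<Longrightarrow> strict_mono_on orthant (u t)"
    and a_integrable: "integrable M a"
    and f_integrable: "integrable M f"
    and f_orthant: "t \<in> space M \<Longrightarrow> f t \<in> orthant"
begin

text \<open>Bundles live on all of \<open>M\<close> rather than on a coalition, so that they can be
  glued along measurable sets.\<close>

definition bundles :: "('t \<Rightarrow> real ^ 'l) set" where
  "bundles = {y. integrable M y \<and> (\<forall>t\<in>space M. y t \<in> orthant)}"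

text \<open>A null set blocks trivially, so positive measure is asked for separately where it
  matters.\<close>

definition blocks :: "'t set \<Rightarrow> bool" where
  "blocks S \<longleftrightarrow> S \<in> sets M \<and> (\<exists>y\<in>bundles.
     (AE t in M. t \<in> S \<longrightarrow> u t (f t) < u t (y t)) \<and> (LINT t:S|M. y t) = (LINT t:S|M. a t))"

text \<open>Strictness is moved from the preferences to the resources: a coalition that blocks weakly
  with a surplus of every good can pay for small enlargements.\<close>

definition blocks_with_surplus :: "'t set \<Rightarrow> bool" where
  "blocks_with_surplus S \<longleftrightarrow> S \<in> sets M \<and> (\<exists>y\<in>bundles.
     (AE t in M. t \<in> S \<longrightarrow> u t (f t) \<le> u t (y t)) \<and> strictly_positive (LINT t:S|M. a t - y t))"

lemma f_bundles: "f \<in> bundles"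
  by (simp add: bundles_def f_integrable f_orthant)

lemma const_bundles: "x \<in> orthant \<Longrightarrow> (\<lambda>_. x) \<in> bundles"
  by (simp add: bundles_def)

lemma bundles_add: "y \<in> bundles \<Longrightarrow> z \<in> bundles \<Longrightarrow> (\<lambda>t. y t + z t) \<in> bundles"
  by (simp add: bundles_def orthant_add)

lemma bundles_If:
  "y \<in> bundles \<Longrightarrow> z \<in> bundles \<Longrightarrow> A \<in> sets M \<Longrightarrow> (\<lambda>t. if t \<in> A then y t else z t) \<in> bundles"
  by (simp add: bundles_def integrable_If_set)

lemma bundles_set_integrable: "y \<in> bundles \<Longrightarrow> A \<in> sets M \<Longrightarrow> set_integrable M A y"
  by (simp add: bundles_def integrable_imp_set_integrable)

lemma a_set_integrable: "A \<in> sets M \<Longrightarrow> set_integrable M A a"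
  by (simp add: a_integrable integrable_imp_set_integrable)

lemma utility_measurable: "y \<in> bundles \<Longrightarrow> (\<lambda>t. u t (y t)) \<in> borel_measurable M"
  by (rule caratheodory_measurable) (auto simp: u_measurable u_continuous bundles_def)

lemma u_less: "t \<in> space M \<Longrightarrow> x \<in> orthant \<Longrightarrow> y \<in> orthant \<Longrightarrow> x < y \<Longrightarrow> u t x < u t y"
  using u_mono[of t] by (auto simp: monotone_on_def)

text \<open>Over a null set the surplus would be 0, which is not strictly positive.\<close>

lemma blocks_with_surplus_pos:
  assumes "blocks_with_surplus S"
  shows "0 < measure M S"
proof (rule ccontr)
  assume "\<not> 0 < measure M S"
  with assms have "S \<in> null_sets M"
    by (auto simp: blocks_with_surplus_def emeasure_eq_measure zero_less_measure_iff)
  then have "AE t in M. t \<notin> S"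
    by (rule AE_not_in)
  then have "(LINT t:S|M. a t - y t) = 0" for y
    unfolding set_lebesgue_integral_def by (intro integral_eq_zero_AE) auto
  then show False
    using assms strictly_positive_neq_0 by (auto simp: blocks_with_surplus_def)
qed

text \<open>The surplus is handed out in equal amounts \<open>s\<close>. This uses up the resources
  exactly, and strict monotonicity turns weak preference into strict preference.\<close>

lemma blocks_with_surplus_imp_blocks:
  assumes "blocks_with_surplus S"
  shows "blocks S"
proof -
  obtain y where S [measurable]: "S \<in> sets M" and y: "y \<in> bundles"
    "AE t in M. t \<in> S \<longrightarrow> u t (f t) \<le> u t (y t)" "strictly_positive (LINT t:S|M. a t - y t)"
    using assms by (auto simp: blocks_with_surplus_def)
  have pos: "0 < measure M S"
    using assms by (rule blocks_with_surplus_pos)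
  define s where "s = (LINT t:S|M. a t - y t) /\<^sub>R measure M S"
  have s: "strictly_positive s"
    unfolding s_def using pos y by (intro strictly_positive_scaleR) auto
  let ?z = "\<lambda>t. y t + s"
  have "?z \<in> bundles"
    using y s by (intro bundles_add const_bundles strictly_positive_orthant)
  moreover have "AE t in M. t \<in> S \<longrightarrow> u t (f t) < u t (?z t)"
    using y(2) AE_space
  proof eventually_elim
    case (elim t)
    have "u t (y t) < u t (?z t)"
      using elim y s \<open>?z \<in> bundles\<close>
      by (intro u_less less_add_strictly_positive) (auto simp: bundles_def)
    with elim show ?case by auto
  qed
  moreover have "(LINT t:S|M. ?z t) = (LINT t:S|M. a t)"
  proof -
    have "(LINT t:S|M. ?z t) = (LINT t:S|M. y t) + (LINT t:S|M. s)"
      using y by (intro set_integral_add) (auto intro: bundles_set_integrable integrable_imp_set_integrable)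
    also have "(LINT t:S|M. s) = (LINT t:S|M. a t) - (LINT t:S|M. y t)"
    proof -
      have "(LINT t:S|M. s) = measure M S *\<^sub>R s"
        by (simp add: set_lebesgue_integral_def emeasure_eq_measure)
      also have "\<dots> = (LINT t:S|M. a t - y t)"
        using pos by (simp add: s_def)
      finally show ?thesis
        using y by (simp add: bundles_set_integrable a_set_integrable)
    qed
    finally show ?thesis by simp
  qed
  ultimately show ?thesis
    using S by (auto simp: blocks_def)
qed

text \<open>Every member of a blocking coalition scales its bundle by \<open>1 - 1 / (n + 1)\<close>, with the least
  \<open>n\<close> for which the scaled bundle is still preferred.\<close>

lemma blocks_imp_blocks_with_surplus:
  assumes "blocks S" and pos: "0 < measure M S" and a: "AE t in M. strictly_positive (a t)"
  shows "blocks_with_surplus S"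
proof -
  obtain g where S [measurable]: "S \<in> sets M" and g: "g \<in> bundles"
    "AE t in M. t \<in> S \<longrightarrow> u t (f t) < u t (g t)" and g_eq: "(LINT t:S|M. g t) = (LINT t:S|M. a t)"
    using assms by (auto simp: blocks_def)
  have [measurable]: "g \<in> borel_measurable M"
    using g(1) by (auto simp: bundles_def)
  define scale where "scale n = 1 - inverse (real (Suc n))" for n
  have scale: "0 \<le> scale n" "scale n < 1" for n
    by (auto simp: scale_def field_simps)
  have sg: "(\<lambda>t. scale n *\<^sub>R g t) \<in> bundles" for n
    using g(1) scale by (auto simp: bundles_def intro!: orthant_scaleR)
  note [measurable] = utility_measurable[OF sg] utility_measurable[OF f_bundles]
  \<comment> \<open>Where no \<open>n\<close> qualifies, the value is unspecified; this is harmless,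
    since every \<open>scale n\<close> lies between 0 and 1, so \<open>y\<close> is still a
    bundle.\<close>
  define N where "N t = (LEAST n. u t (f t) < u t (scale n *\<^sub>R g t))" for t
  have N [measurable]: "N \<in> M \<rightarrow>\<^sub>M count_space UNIV"
    unfolding N_def by measurable
  define y where "y t = scale (N t) *\<^sub>R g t" for t
  have y: "y \<in> bundles"
  proof -
    have "integrable M y"
    proof (rule Bochner_Integration.integrable_bound)
      show "integrable M g"
        using g by (simp add: bundles_def)
      show "AE t in M. norm (y t) \<le> norm (g t)"
        using scale by (auto simp: y_def mult_left_le_one_le less_imp_le)
    qed (unfold y_def, intro borel_measurable_scaleR measurable_compose[OF N], simp_all)
    then show ?thesis
      using g(1) scale by (auto simp: bundles_def y_def intro!: orthant_scaleR)
  qed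
  have "AE t in M. t \<in> S \<longrightarrow> u t (f t) \<le> u t (y t)"
    using g(2) AE_space
  proof eventually_elim
    case (elim t)
    show ?case
    proof
      assume "t \<in> S"
      have "(\<lambda>n. scale n *\<^sub>R g t) \<longlonglongrightarrow> (1 - 0) *\<^sub>R g t"
        unfolding scale_def by (intro tendsto_intros LIMSEQ_inverse_real_of_nat)
      then have "(\<lambda>n. u t (scale n *\<^sub>R g t)) \<longlonglongrightarrow> u t (g t)"
        using elim g(1) sg
        by (intro continuous_on_tendsto_compose[OF u_continuous]) (auto simp: bundles_def)
      then have "\<forall>\<^sub>F n in sequentially. u t (f t) < u t (scale n *\<^sub>R g t)"
        using elim \<open>t \<in> S\<close> by (intro order_tendstoD) auto
      then obtain n where "u t (f t) < u t (scale n *\<^sub>R g t)"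
        by (auto dest: eventually_happens)
      then show "u t (f t) \<le> u t (y t)"
        unfolding y_def N_def by (rule LeastI2) simp
    qed
  qed
  moreover have "strictly_positive (LINT t:S|M. a t - y t)"
    unfolding strictly_positive_def
  proof
    fix k
    have nonneg: "0 \<le> g t $ k" if "t \<in> space M" for t
      using g(1) that by (auto simp: bundles_def orthant_def less_eq_vec_def)
    have gS: "set_integrable M S g" and aS: "set_integrable M S a" and yS: "set_integrable M S y"
      using g y S by (auto intro: bundles_set_integrable a_set_integrable)
    have kS: "set_integrable M S (\<lambda>t. h t $ k)" if "set_integrable M S h" for h :: "'t \<Rightarrow> real ^ 'l"
      using integrable_bounded_linear[OF bounded_linear_vec_nth that[unfolded set_integrable_def], of k]
      by (simp add: set_integrable_def)
    \<comment> \<open>As \<open>g\<close> uses up the resources of \<open>S\<close>, the surplus is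
      exactly what the scaling releases.\<close>
    have diff: "(LINT t:S|M. a t - y t) = (LINT t:S|M. g t - y t)"
      using gS aS yS g_eq by simp
    have eq: "(LINT t:S|M. g t - y t) $ k = (LINT t:S|M. (1 - scale (N t)) * g t $ k)"
    proof -
      have "(LINT t:S|M. g t - y t) $ k = (LINT t:S|M. (g t - y t) $ k)"
        using gS yS by (intro set_integral_vec_nth) auto
      then show ?thesis
        by (simp add: y_def algebra_simps)
    qed
    let ?d = "\<lambda>t. indicator S t *\<^sub>R ((1 - scale (N t)) * g t $ k)"
    have int: "integrable M ?d"
      using kS[OF set_integral_diff(1)[OF gS yS]] unfolding set_integrable_def
      by (simp add: y_def algebra_simps)
    have d_nonneg: "AE t in M. 0 \<le> ?d t"
      using nonneg scale by (auto split: split_indicator intro!: mult_nonneg_nonneg simp: less_imp_le)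
    \<comment> \<open>Each factor \<open>1 - scale (N t)\<close> is positive. If nothing of good
      \<open>k\<close> were released, \<open>g\<close> would contain none of it on \<open>S\<close>,
      and \<open>S\<close> would own none of it, against the positive endowments.\<close>
    have "(LINT t:S|M. g t - y t) $ k \<noteq> 0"
    proof
      assume "(LINT t:S|M. g t - y t) $ k = 0"
      then have "(LINT t|M. ?d t) = 0"
        unfolding eq unfolding set_lebesgue_integral_def .
      then have "AE t in M. ?d t = 0"
        using integral_nonneg_eq_0_iff_AE[OF int d_nonneg] by (rule iffD1[rotated])
      then have "AE t in M. indicator S t *\<^sub>R g t $ k = 0"
      proof eventually_elim
        case (elim t)
        then show ?case
          using scale(2)[of "N t"] by (auto split: split_indicator)
      qed
      then have "(LINT t:S|M. g t $ k) = 0"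
        unfolding set_lebesgue_integral_def by (rule integral_eq_zero_AE)
      then have "(LINT t:S|M. a t $ k) = 0"
        using set_integral_vec_nth[OF gS, of k] set_integral_vec_nth[OF aS, of k] g_eq by simp
      then have "AE t in M. indicator S t *\<^sub>R a t $ k = 0"
        using kS[OF aS] a unfolding set_lebesgue_integral_def set_integrable_def
        by (subst (asm) integral_nonneg_eq_0_iff_AE)
           (auto split: split_indicator simp: strictly_positive_def less_imp_le elim!: eventually_mono)
      with a have "AE t in M. t \<notin> S"
        by eventually_elim (auto simp: strictly_positive_def split: split_indicator_asm, metis less_irrefl)
      then have "S \<in> null_sets M"
        by (simp add: AE_iff_null_sets)
      with pos show False
        by (auto simp: null_sets_def measure_def)
    qed
    moreover have "0 \<le> (LINT t:S|M. g t - y t) $ k"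
      unfolding eq unfolding set_lebesgue_integral_def using d_nonneg by (rule integral_nonneg_AE)
    ultimately show "0 < (LINT t:S|M. a t - y t) $ k"
      unfolding diff by simp
  qed
  ultimately show ?thesis
    using S y by (auto simp: blocks_with_surplus_def)
qed

end

section \<open>Enlarging a coalition\<close>

lemma set_integral_null_diff:
  fixes h :: "'a \<Rightarrow> 'b::{banach, second_countable_topology}"
  assumes "S \<in> sets M" "B \<in> sets M" "B \<subseteq> S" "S - B \<in> null_sets M" "h \<in> borel_measurable M"
  shows "(LINT t:B|M. h t) = (LINT t:S|M. h t)"
proof (rule set_integral_cong_set)
  show "AE x in M. x \<in> S \<longleftrightarrow> x \<in> B"
    using AE_not_in[OF assms(4)] by eventually_elim (use assms(3) in auto)
qed (use assms in \<open>auto simp: set_borel_measurable_def\<close>)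

context pure_exchange
begin

text \<open>This serves to drop the null part of a coalition that meets the large traders.\<close>

lemma blocks_with_surplus_null_diff:
  assumes S: "blocks_with_surplus S" and B: "B \<in> sets M" "B \<subseteq> S" "measure M (S - B) = 0"
  shows "blocks_with_surplus B"
proof -
  obtain y where Sm: "S \<in> sets M" and y: "y \<in> bundles"
    "AE t in M. t \<in> S \<longrightarrow> u t (f t) \<le> u t (y t)" "strictly_positive (LINT t:S|M. a t - y t)"
    using S by (auto simp: blocks_with_surplus_def)
  have "S - B \<in> null_sets M"
    using Sm B by (auto simp: emeasure_eq_measure)
  then have "(LINT t:B|M. a t - y t) = (LINT t:S|M. a t - y t)"
    using Sm B y(1) a_integrable by (intro set_integral_null_diff) (auto simp: bundles_def)
  moreover have "AE t in M. t \<in> B \<longrightarrow> u t (f t) \<le> u t (y t)"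
    using y(2) by eventually_elim (use B(2) in auto)
  ultimately show ?thesis
    using B(1) y by (auto simp: blocks_with_surplus_def)
qed

text \<open>Newcomers keep \<open>f\<close>. If their net trades are bounded and their measure is
  small, they change the surplus by at most the tolerated error.\<close>

lemma blocks_with_surplus_enlarge:
  assumes S: "blocks_with_surplus S" and P: "atomless_on M P" "0 < measure M P"
  shows "\<exists>B\<in>sets M. B \<subseteq> P \<and> 0 < measure M B \<and> blocks_with_surplus (S \<union> B)"
proof -
  obtain y where Sm [measurable]: "S \<in> sets M" and y: "y \<in> bundles"
    "AE t in M. t \<in> S \<longrightarrow> u t (f t) \<le> u t (y t)" "strictly_positive (LINT t:S|M. a t - y t)"
    using S by (auto simp: blocks_with_surplus_def)
  obtain e where e: "0 < e"
    "\<And>z. norm (z - (LINT t:S|M. a t - y t)) \<le> e \<Longrightarrow> strictly_positive z"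
    using strictly_positive_nearby[OF y(3)] by blast
  have Pm [measurable]: "P \<in> sets M"
    using P by (simp add: atomless_on_def)
  note [measurable] = borel_measurable_integrable[OF a_integrable] borel_measurable_integrable[OF f_integrable]
  \<comment> \<open>Truncation makes the net trade bounded; the sets increase to \<open>P\<close>,
    so some \<open>Q n\<close> has positive measure.\<close>
  define Q where "Q n = {t \<in> P. norm (a t - f t) \<le> real n}" for n
  have Q [measurable]: "Q n \<in> sets M" for n
  proof -
    have "Q n = P \<inter> {t \<in> space M. norm (a t - f t) \<le> real n}"
      using sets.sets_into_space[OF Pm] by (auto simp: Q_def)
    then show ?thesis by simp
  qed
  have "(\<lambda>n. measure M (Q n)) \<longlonglongrightarrow> measure M (\<Union>n. Q n)"
    using Q by (intro finite_Lim_measure_incseq) (auto simp: Q_def incseq_def)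
  moreover have "(\<Union>n. Q n) = P"
    by (auto simp: Q_def intro: real_nat_ceiling_ge)
  ultimately have "\<forall>\<^sub>F n in sequentially. 0 < measure M (Q n)"
    using P(2) by (intro order_tendstoD) auto
  then obtain n where n: "0 < measure M (Q n)"
    by (auto dest: eventually_happens)
  have "atomless_on M (Q n)"
    by (rule atomless_on_subset[OF P(1) Q]) (auto simp: Q_def)
  \<comment> \<open>The summand 1 covers the case that \<open>n\<close> is 0.\<close>
  moreover have "0 < e / (real n + 1)"
    using e by simp
  ultimately obtain B where B [measurable]: "B \<in> sets M" and BQ: "B \<subseteq> Q n"
    and Bpos: "0 < measure M B" and Bsmall: "measure M B \<le> e / (real n + 1)"
    using n atomless_small_subset by metis
  define z where "z t = (if t \<in> S then y t else f t)" for t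
  have z: "z \<in> bundles"
    unfolding z_def using y f_bundles by (intro bundles_If) auto
  have "AE t in M. t \<in> S \<union> B \<longrightarrow> u t (f t) \<le> u t (z t)"
    using y(2) by eventually_elim (auto simp: z_def)
  moreover have "strictly_positive (LINT t:S \<union> B|M. a t - z t)"
  proof (rule e(2))
    have az: "set_integrable M A (\<lambda>t. a t - z t)" if "A \<in> sets M" for A
      using that z by (intro set_integral_diff a_set_integrable bundles_set_integrable)
    \<comment> \<open>\<open>B\<close> may overlap \<open>S\<close>. Agents in the overlap stay with
      \<open>y\<close>, so only \<open>B - S\<close> changes the surplus.\<close>
    have "S \<union> B = S \<union> (B - S)" by blast
    then have "(LINT t:S \<union> B|M. a t - z t) = (LINT t:S|M. a t - z t) + (LINT t:B - S|M. a t - z t)"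
      by (simp only:) (intro set_integral_Un az, auto)
    also have "(LINT t:S|M. a t - z t) = (LINT t:S|M. a t - y t)"
      by (intro set_lebesgue_integral_cong) (auto simp: z_def)
    finally have "norm ((LINT t:S \<union> B|M. a t - z t) - (LINT t:S|M. a t - y t))
        = norm (LINT t:B - S|M. a t - z t)" by simp
    also have "\<dots> \<le> (LINT t:B - S|M. norm (a t - z t))"
      by (intro set_integral_norm_bound az) auto
    also have "\<dots> \<le> (LINT t:B|M. real n)"
      unfolding set_lebesgue_integral_def
    proof (rule integral_mono)
      show "integrable M (\<lambda>t. indicator (B - S) t *\<^sub>R norm (a t - z t))"
        using set_integrable_norm[OF az[of "B - S"]] by (simp add: set_integrable_def)
      show "integrable M (\<lambda>t. indicator B t *\<^sub>R real n)"
        by (simp add: emeasure_eq_measure)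
      show "indicator (B - S) t *\<^sub>R norm (a t - z t) \<le> indicator B t *\<^sub>R real n" for t
        using BQ by (auto simp: z_def Q_def split: split_indicator)
    qed
    also have "\<dots> = measure M B * real n"
      by (simp add: set_lebesgue_integral_def emeasure_eq_measure)
    also have "\<dots> \<le> e / (real n + 1) * (real n + 1)"
      using Bsmall e by (intro mult_mono) auto
    also have "\<dots> = e" by (simp add: add_pos_nonneg add_eq_0_iff_both_eq_0)
    finally show "norm ((LINT t:S \<union> B|M. a t - z t) - (LINT t:S|M. a t - y t)) \<le> e" .
  qed
  ultimately have "blocks_with_surplus (S \<union> B)"
    using z by (auto simp: blocks_with_surplus_def)
  then show ?thesis
    using BQ Bpos by (intro bexI[of _ B]) (auto simp: Q_def)
qed

text \<open>Each \<open>P i\<close> either meets the starting coalition already or has a part in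
  \<open>N\<close> from which newcomers can be drawn. One index is treated at a time.\<close>

lemma blocks_with_surplus_enlarge_family:
  assumes "finite I" and S: "blocks_with_surplus S" and N: "atomless_on M N"
    and P: "\<And>i. i \<in> I \<Longrightarrow> P i \<in> sets M"
      "\<And>i. i \<in> I \<Longrightarrow> 0 < measure M (S \<inter> P i) \<or> 0 < measure M (P i \<inter> N)"
  shows "\<exists>S'. S \<subseteq> S' \<and> blocks_with_surplus S' \<and> (\<forall>i\<in>I. 0 < measure M (S' \<inter> P i))"
  using assms(1) P
proof (induction I)
  case empty
  then show ?case using S by auto
next
  case (insert i I)
  then obtain S' where S': "S \<subseteq> S'" "blocks_with_surplus S'" "\<forall>j\<in>I. 0 < measure M (S' \<inter> P j)"
    by auto
  \<comment> \<open>Coalitions only grow, so an index once represented remains represented.\<close>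
  have grow: "0 < measure M (T' \<inter> P j)"
    if "0 < measure M (T \<inter> P j)" "T \<subseteq> T'" "blocks_with_surplus T'" "j \<in> insert i I" for T T' j
  proof -
    have "measure M (T \<inter> P j) \<le> measure M (T' \<inter> P j)"
      using that insert.prems(1) by (intro finite_measure_mono) (auto simp: blocks_with_surplus_def)
    with that(1) show ?thesis by simp
  qed
  show ?case
  proof (cases "0 < measure M (S \<inter> P i)")
    case True
    then show ?thesis
      using S' grow[OF True] by (intro exI[of _ S']) auto
  next
    case False
    then have "0 < measure M (P i \<inter> N)"
      using insert.prems(2)[of i] by simp
    moreover have "atomless_on M (P i \<inter> N)"
      using insert.prems(1)[of i] N by (intro atomless_on_subset[OF N]) (auto simp: atomless_on_def)
    ultimately obtain B where B: "B \<in> sets M" "B \<subseteq> P i \<inter> N" "0 < measure M B" "blocks_with_surplus (S' \<union> B)"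
      using blocks_with_surplus_enlarge[OF S'(2)] by blast
    have "B \<inter> P i = B" using B by auto
    have "0 < measure M ((S' \<union> B) \<inter> P i)"
      by (rule grow[of B]) (simp_all add: \<open>B \<inter> P i = B\<close> B)
    moreover have "0 < measure M ((S' \<union> B) \<inter> P j)" if "j \<in> I" for j
      by (rule grow[of S']) (use that S'(3) B(4) in simp_all)
    ultimately show ?thesis
      using S' B by (intro exI[of _ "S' \<union> B"]) auto
  qed
qed

end

section \<open>Bringing a large trader into a blocking coalition\<close>

text \<open>At a fixed state, equal characteristics of the large agents amount to one utility
  \<open>u0\<close> and one endowment \<open>a0\<close>. Having two atoms keeps the share of each
  one below 1.\<close>

locale large_traders = pure_exchange M u a f for M :: "'t measure"
    and u :: "'t \<Rightarrow> real ^ 'l::finite \<Rightarrow> real" and a f :: "'t \<Rightarrow> real ^ 'l" +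
  fixes \<A> :: "'t set set" and u0 :: "real ^ 'l \<Rightarrow> real" and a0 :: "real ^ 'l"
  assumes countable_atoms: "countable \<A>"
    and disjoint_atoms: "disjoint \<A>"
    and atoms: "A \<in> \<A> \<Longrightarrow> measure_atom M A"
    and two_atoms: "\<exists>A\<in>\<A>. \<exists>B\<in>\<A>. A \<noteq> B"
    and atomless_rest: "atomless_on M (space M - \<Union>\<A>)"
    and common_utility: "t \<in> \<Union>\<A> \<Longrightarrow> x \<in> orthant \<Longrightarrow> u t x = u0 x"
    and common_endowment: "t \<in> \<Union>\<A> \<Longrightarrow> a t = a0"
    and quasi_concave: "quasi_concave_on orthant u0"
    and feasible: "(LINT t|M. f t) = (LINT t|M. a t)"
begin

lemma atom_sets: "A \<in> \<A> \<Longrightarrow> A \<in> sets M"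
  and atom_pos: "A \<in> \<A> \<Longrightarrow> 0 < measure M A"
  using atoms by (auto simp: measure_atom_def emeasure_eq_measure)

lemma Union_atoms_sets: "\<Union>\<A> \<in> sets M"
  using countable_atoms atom_sets by auto

lemma Union_atoms_pos: "0 < measure M (\<Union>\<A>)"
proof -
  obtain A where "A \<in> \<A>" using two_atoms by auto
  then have "measure M A \<le> measure M (\<Union>\<A>)"
    using Union_atoms_sets by (intro finite_measure_mono) auto
  with atom_pos[OF \<open>A \<in> \<A>\<close>] show ?thesis by simp
qed

text \<open>Every atom is disjoint from at least one of two fixed distinct atoms. The gap has to be
  uniform because it enters the choice of the extra \<open>c\<close>, which is made before the atom
  is known.\<close>

lemma atoms_measure_gap:
  obtains m where "0 < m" "\<And>A. A \<in> \<A> \<Longrightarrow> measure M A + m \<le> measure M (\<Union>\<A>)"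
proof -
  obtain A1 A2 where A12: "A1 \<in> \<A>" "A2 \<in> \<A>" "A1 \<noteq> A2"
    using two_atoms by auto
  have two: "measure M A + measure M B \<le> measure M (\<Union>\<A>)" if "A \<in> \<A>" "B \<in> \<A>" "A \<noteq> B" for A B
  proof -
    have "measure M A + measure M B = measure M (A \<union> B)"
      using that disjoint_atoms atom_sets
      by (intro finite_measure_Union[symmetric]) (auto dest: disjointD)
    also have "\<dots> \<le> measure M (\<Union>\<A>)"
      using that Union_atoms_sets by (intro finite_measure_mono) auto
    finally show ?thesis .
  qed
  show ?thesis
  proof (rule that)
    show "0 < min (measure M A1) (measure M A2)"
      using A12 atom_pos by simp
    show "measure M A + min (measure M A1) (measure M A2) \<le> measure M (\<Union>\<A>)" if "A \<in> \<A>" for A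
      using two[OF that, of A1] two[OF that, of A2] A12 by (cases "A = A1") auto
  qed
qed

definition mean_bundle :: "real ^ 'l" where
  "mean_bundle = (LINT t:\<Union>\<A>|M. f t) /\<^sub>R measure M (\<Union>\<A>)"

lemma mean_bundle_orthant: "mean_bundle \<in> orthant"
  unfolding mean_bundle_def
  using f_orthant AE_space
  by (intro mean_in_closed_convex convex_orthant closed_orthant f_integrable Union_atoms_sets Union_atoms_pos)
     (auto elim!: eventually_mono)

text \<open>If every large trader liked its bundle better than the mean bundle plus \<open>c\<close>, then by
  quasi-concavity so would the mean bundle itself.\<close>

lemma atom_not_above_mean:
  assumes c: "strictly_positive c"
  obtains A where "A \<in> \<A>" "AE t in M. t \<in> A \<longrightarrow> u t (f t) \<le> u t (mean_bundle + c)"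
proof -
  note [measurable] = Union_atoms_sets utility_measurable[OF f_bundles]
  have mc: "mean_bundle + c \<in> orthant"
    using c by (intro orthant_add mean_bundle_orthant strictly_positive_orthant)
  have "\<Union>\<A> \<noteq> {}"
    using Union_atoms_pos by (metis measure_empty less_irrefl)
  then obtain t0 where t0: "t0 \<in> \<Union>\<A>" "t0 \<in> space M"
    using sets.sets_into_space[OF Union_atoms_sets] by blast
  have cont: "continuous_on orthant u0"
    using u_continuous[OF t0(2)] common_utility[OF t0(1)] continuous_on_cong by blast
  define C where "C = {x \<in> orthant. u0 (mean_bundle + c) \<le> u0 x}"
  have "closed C"
    unfolding C_def by (intro continuous_closed_preimage_constant continuous_on_closed_Collect_le cont closed_orthant continuous_on_const)
  have "convex C"
    unfolding convex_alt
  proof (intro ballI allI impI)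
    fix x y and r :: real assume xy: "x \<in> C" "y \<in> C" and r: "0 \<le> r \<and> r \<le> 1"
    have "min (u0 y) (u0 x) \<le> u0 (r *\<^sub>R y + (1 - r) *\<^sub>R x)"
      using quasi_concave xy r by (auto simp: quasi_concave_on_def C_def)
    moreover have "(1 - r) *\<^sub>R x + r *\<^sub>R y \<in> orthant"
      using xy r by (auto simp: C_def intro!: orthant_add orthant_scaleR)
    ultimately show "(1 - r) *\<^sub>R x + r *\<^sub>R y \<in> C"
      using xy by (auto simp: C_def add.commute)
  qed
  have "\<not> (AE t in M. t \<in> \<Union>\<A> \<longrightarrow> f t \<in> C)"
  proof
    assume "AE t in M. t \<in> \<Union>\<A> \<longrightarrow> f t \<in> C"
    then have "mean_bundle \<in> C"
      unfolding mean_bundle_def using \<open>convex C\<close> \<open>closed C\<close>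
      by (intro mean_in_closed_convex f_integrable Union_atoms_sets Union_atoms_pos)
    then have "u t0 (mean_bundle + c) \<le> u t0 mean_bundle"
      using common_utility[OF t0(1)] mc by (auto simp: C_def)
    moreover have "u t0 mean_bundle < u t0 (mean_bundle + c)"
      using t0 mc c by (intro u_less mean_bundle_orthant less_add_strictly_positive)
    ultimately show False by simp
  qed
  moreover have "AE t in M. t \<in> \<Union>\<A> \<longrightarrow> f t \<in> C"
    if all: "\<And>A. A \<in> \<A> \<Longrightarrow> AE t in M. t \<in> A \<longrightarrow> u t (mean_bundle + c) \<le> u t (f t)"
  proof -
    \<comment> \<open>Countability of the family merges the exceptional null sets of the single
      atoms.\<close>
    have "AE t in M. \<forall>A\<in>\<A>. t \<in> A \<longrightarrow> u t (mean_bundle + c) \<le> u t (f t)"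
      using all by (intro AE_ball_countable[OF countable_atoms, THEN iffD2] ballI)
    with AE_space show ?thesis
    proof eventually_elim
      case (elim t)
      then show ?case
        using f_orthant common_utility[of t] mc unfolding C_def by fastforce
    qed
  qed
  ultimately obtain A where A: "A \<in> \<A>" "\<not> (AE t in M. t \<in> A \<longrightarrow> u t (mean_bundle + c) \<le> u t (f t))"
    by blast
  note [measurable] = atom_sets[OF A(1)] u_measurable[OF mc]
  let ?L = "{t \<in> space M. t \<in> A \<and> u t (f t) < u t (mean_bundle + c)}"
  have L: "?L \<in> sets M" by measurable
  have "emeasure M ?L \<noteq> 0"
  proof
    assume "emeasure M ?L = 0"
    with L have "AE t in M. t \<notin> ?L"
      by (intro AE_not_in) auto
    with AE_space have "AE t in M. t \<in> A \<longrightarrow> u t (mean_bundle + c) \<le> u t (f t)"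
      by eventually_elim auto
    with A(2) show False by simp
  qed
  \<comment> \<open>A non-null measurable part of an atom exhausts the atom up to a null
    set.\<close>
  then have "emeasure M (A - ?L) = 0"
    using atoms[OF A(1), unfolded measure_atom_def, THEN conjunct2, THEN conjunct2, rule_format, OF L] by blast
  then have "AE t in M. t \<notin> A - ?L"
    using L by (intro AE_not_in) auto
  then have "AE t in M. t \<in> A \<longrightarrow> u t (f t) \<le> u t (mean_bundle + c)"
    by eventually_elim auto
  with A(1) that show ?thesis by blast
qed

text \<open>Up to the approximation error, the surplus of the new coalition is
  \<open>q *\<^sub>R s\<close>: replacing bundles on the share \<open>r\<close> leaves
  \<open>1 - r\<close> of the old surplus \<open>s\<close>, and the extra \<open>c\<close> for the
  atom costs \<open>measure M A * \<delta>\<close> of it.\<close>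

lemma blocks_with_surplus_absorb_atom:
  assumes S0: "blocks_with_surplus S0" and null: "measure M (S0 \<inter> \<Union>\<A>) = 0"
  shows "\<exists>S. blocks_with_surplus S \<and> 0 < measure M (S \<inter> \<Union>\<A>)"
proof -
  define T1 where "T1 = \<Union>\<A>"
  define N where "N = space M - T1"
  have T1 [measurable]: "T1 \<in> sets M" and T1_pos: "0 < measure M T1"
    using Union_atoms_sets Union_atoms_pos by (auto simp: T1_def)
  have N_atomless: "atomless_on M N"
    using atomless_rest by (simp add: N_def T1_def)
  then have N [measurable]: "N \<in> sets M"
    by (simp add: atomless_on_def)
  \<comment> \<open>Without its null part among the atoms the coalition lies in \<open>N\<close>,
    hence is disjoint from any atom that joins.\<close>
  define S where "S = S0 - T1"
  have "S0 \<in> sets M"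
    using S0 by (simp add: blocks_with_surplus_def)
  moreover have "S0 - (S0 - T1) = S0 \<inter> T1" by auto
  ultimately have "blocks_with_surplus S"
    unfolding S_def using null T1 by (intro blocks_with_surplus_null_diff[OF S0]) (auto simp flip: T1_def)
  then obtain y where S [measurable]: "S \<in> sets M" and y: "y \<in> bundles"
    "AE t in M. t \<in> S \<longrightarrow> u t (f t) \<le> u t (y t)" "strictly_positive (LINT t:S|M. a t - y t)"
    by (auto simp: blocks_with_surplus_def)
  have SN: "S \<subseteq> N"
    using sets.sets_into_space[OF S] by (auto simp: N_def S_def)
  define s where "s = (LINT t:S|M. a t - y t)"
  obtain m where m: "0 < m" "\<And>A. A \<in> \<A> \<Longrightarrow> measure M A + m \<le> measure M T1"
    unfolding T1_def using atoms_measure_gap by blast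
  \<comment> \<open>The cost \<open>measure M A * \<delta>\<close> is then at most half of
    \<open>m / measure M T1\<close>, which bounds \<open>1 - r\<close> from below; thus
    \<open>q\<close> is positive whichever atom is chosen.\<close>
  define \<delta> where "\<delta> = m / (2 * (measure M T1)\<^sup>2)"
  have \<delta>: "0 < \<delta>"
    using m(1) T1_pos by (simp add: \<delta>_def)
  define c where "c = \<delta> *\<^sub>R s"
  have c: "strictly_positive c"
    unfolding c_def s_def using \<delta> y(3) by (rule strictly_positive_scaleR)
  obtain A where A: "A \<in> \<A>" "AE t in M. t \<in> A \<longrightarrow> u t (f t) \<le> u t (mean_bundle + c)"
    using atom_not_above_mean[OF c] by blast
  have Am [measurable]: "A \<in> sets M" and A_pos: "0 < measure M A" and AT: "A \<subseteq> T1"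
    using A(1) atom_sets atom_pos by (auto simp: T1_def)
  define r where "r = measure M A / measure M T1"
  have A_le: "measure M A \<le> measure M T1"
    using m(2)[OF A(1)] m(1) by simp
  have r: "0 \<le> r" "r \<le> 1"
    using T1_pos A_le by (auto simp: r_def field_simps)
  define q where "q = (1 - r) - measure M A * \<delta>"
  have "0 < q"
  proof -
    define g where "g = m / measure M T1"
    have "0 < g"
      using m(1) T1_pos by (simp add: g_def)
    moreover have "g \<le> 1 - r"
      using m(2)[OF A(1)] T1_pos by (simp add: g_def r_def field_simps)
    moreover have "measure M A * \<delta> \<le> g / 2"
    proof -
      have "measure M A * \<delta> \<le> measure M T1 * \<delta>"
        using A_le \<delta> by (intro mult_right_mono) auto
      also have "\<dots> = g / 2"
        using T1_pos by (simp add: g_def \<delta>_def power2_eq_square)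
      finally show ?thesis .
    qed
    ultimately show ?thesis
      unfolding q_def by linarith
  qed
  then have "strictly_positive (q *\<^sub>R s)"
    using y(3) by (intro strictly_positive_scaleR) (auto simp: s_def)
  then obtain e where e: "0 < e" "\<And>z. norm (z - q *\<^sub>R s) \<le> e \<Longrightarrow> strictly_positive z"
    using strictly_positive_nearby by metis
  have y_int: "integrable M y"
    using y(1) by (simp add: bundles_def)
  have ind: "integrable M (\<lambda>t. indicator S t *\<^sub>R (a t - y t))"
    using a_integrable y_int by (intro integrable_mult_indicator) auto
  \<comment> \<open>The integral of \<open>h\<close> over \<open>D\<close> is the net change of
    surplus when \<open>D\<close> joins with \<open>f\<close> and \<open>D \<inter> S\<close> gives
    up \<open>y\<close>; a single function thus controls both effects.\<close>
  define h where "h t = (a t - f t) - indicator S t *\<^sub>R (a t - y t)" for t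
  have h: "integrable M h"
    unfolding h_def by (intro Bochner_Integration.integrable_diff a_integrable f_integrable ind)
  obtain D where D [measurable]: "D \<in> sets M" and DN: "D \<subseteq> N"
    and D_approx: "norm ((LINT t:D|M. h t) - r *\<^sub>R (LINT t:N|M. h t)) \<le> e"
    using atomless_approximate_Lyapunov[OF h N_atomless e(1) r] by blast
  define z where "z t = (if t \<in> A then mean_bundle + c else if t \<in> D then f t else y t)" for t
  have z: "z \<in> bundles"
    unfolding z_def using c y(1)
    by (intro bundles_If const_bundles f_bundles orthant_add mean_bundle_orthant strictly_positive_orthant) auto
  let ?S = "A \<union> (D \<union> (S - D))"
  have AD: "A \<inter> N = {}"
    using AT by (auto simp: N_def)
  have better: "AE t in M. t \<in> ?S \<longrightarrow> u t (f t) \<le> u t (z t)"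
    using y(2) A(2) by eventually_elim (auto simp: z_def)
  have on: "set_integrable M B g" if "integrable M g" "B \<in> sets M" for B and g :: "'t \<Rightarrow> real ^ 'l"
    using that by (rule integrable_imp_set_integrable)
  have az: "integrable M (\<lambda>t. a t - z t)" and ay: "integrable M (\<lambda>t. a t - y t)"
    and af: "integrable M (\<lambda>t. a t - f t)"
    using z a_integrable f_integrable y_int by (auto simp: bundles_def)
  have split: "(LINT t:?S|M. a t - z t) =
      (LINT t:A|M. a t - z t) + ((LINT t:D|M. a t - z t) + (LINT t:S - D|M. a t - z t))"
  proof -
    have "(LINT t:?S|M. a t - z t) = (LINT t:A|M. a t - z t) + (LINT t:D \<union> (S - D)|M. a t - z t)"
      using AD DN SN az by (intro set_integral_Un on) auto
    also have "(LINT t:D \<union> (S - D)|M. a t - z t) = (LINT t:D|M. a t - z t) + (LINT t:S - D|M. a t - z t)"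
      using az by (intro set_integral_Un on) auto
    finally show ?thesis .
  qed
  have h_on: "(LINT t:B|M. h t) = (LINT t:B|M. a t - f t) - (LINT t:B \<inter> S|M. a t - y t)"
    if [measurable]: "B \<in> sets M" for B
  proof -
    have "(LINT t:B|M. h t) = (LINT t:B|M. a t - f t) - (LINT t:B|M. indicator S t *\<^sub>R (a t - y t))"
      unfolding h_def by (intro set_integral_diff on af ind) auto
    also have "(LINT t:B|M. indicator S t *\<^sub>R (a t - y t)) = (LINT t:B \<inter> S|M. a t - y t)"
      unfolding set_lebesgue_integral_def
      by (intro Bochner_Integration.integral_cong) (auto split: split_indicator)
    finally show ?thesis .
  qed
  have "(LINT t:A|M. a t - z t) = (LINT t:A|M. a0 - mean_bundle - c)"
    using A(1) common_endowment by (intro set_lebesgue_integral_cong) (auto simp: z_def)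
  also have "\<dots> = measure M A *\<^sub>R (a0 - mean_bundle) - measure M A *\<^sub>R c"
    by (simp add: set_lebesgue_integral_def emeasure_eq_measure scaleR_diff_right)
  \<comment> \<open>With a common endowment, the atom at the mean bundle makes exactly its share
    \<open>r\<close> of the net trade of all large traders.\<close>
  also have "measure M A *\<^sub>R (a0 - mean_bundle) = r *\<^sub>R (LINT t:T1|M. a t - f t)"
  proof -
    have "(LINT t:T1|M. a t) = (LINT t:T1|M. a0)"
      using common_endowment T1 by (intro set_lebesgue_integral_cong) (simp_all add: T1_def)
    also have "\<dots> = measure M T1 *\<^sub>R a0"
      by (simp add: set_lebesgue_integral_def emeasure_eq_measure)
    finally have "(LINT t:T1|M. a t - f t) = measure M T1 *\<^sub>R a0 - (LINT t:T1|M. f t)"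
      by (simp add: on a_integrable f_integrable)
    also have "(LINT t:T1|M. f t) = measure M T1 *\<^sub>R mean_bundle"
      using T1_pos by (simp add: mean_bundle_def T1_def)
    finally show ?thesis
      using T1_pos by (simp add: r_def flip: scaleR_diff_right)
  qed
  finally have on_A: "(LINT t:A|M. a t - z t) = r *\<^sub>R (LINT t:T1|M. a t - f t) - measure M A *\<^sub>R c" .
  have on_D: "(LINT t:D|M. a t - z t) = (LINT t:D|M. a t - f t)"
    using AD DN by (intro set_lebesgue_integral_cong) (auto simp: z_def)
  have on_S: "(LINT t:S - D|M. a t - z t) = s - (LINT t:D \<inter> S|M. a t - y t)"
  proof -
    have "(LINT t:S - D|M. a t - z t) = (LINT t:S - D|M. a t - y t)"
      using AD SN by (intro set_lebesgue_integral_cong) (auto simp: z_def)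
    moreover have "S = (S - D) \<union> (D \<inter> S)" by blast
    then have "s = (LINT t:(S - D) \<union> (D \<inter> S)|M. a t - y t)"
      by (simp add: s_def)
    then have "s = (LINT t:S - D|M. a t - y t) + (LINT t:D \<inter> S|M. a t - y t)"
      using ay by (subst (asm) set_integral_Un) (auto intro: on)
    ultimately show ?thesis by simp
  qed
  \<comment> \<open>Feasibility of \<open>f\<close>: the net trades of large and small traders
    cancel.\<close>
  have whole: "(LINT t:T1|M. a t - f t) + (LINT t:N|M. a t - f t) = 0"
  proof -
    have "T1 \<union> N = space M"
      using sets.sets_into_space[OF T1] by (auto simp: N_def)
    have "(LINT t:T1|M. a t - f t) + (LINT t:N|M. a t - f t) = (LINT t:T1 \<union> N|M. a t - f t)"
      using af by (intro set_integral_Un[symmetric] on) (auto simp: N_def)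
    also have "\<dots> = (LINT t|M. a t - f t)"
      unfolding \<open>T1 \<union> N = space M\<close> using af by (rule set_integral_space)
    finally show ?thesis
      using feasible a_integrable f_integrable by simp
  qed
  have "N \<inter> S = S" using SN by auto
  then have on_N: "(LINT t:N|M. h t) = (LINT t:N|M. a t - f t) - s"
    using h_on[OF N] by (simp add: s_def)
  \<comment> \<open>The first difference is the approximation error; the last summand vanishes by
    \<open>whole\<close>.\<close>
  have "(LINT t:?S|M. a t - z t) - q *\<^sub>R s = (LINT t:D|M. h t) - r *\<^sub>R (LINT t:N|M. h t)
      + r *\<^sub>R ((LINT t:T1|M. a t - f t) + (LINT t:N|M. a t - f t))"
    unfolding split on_A on_D on_S on_N h_on[OF D] c_def q_def by (simp add: algebra_simps)
  then have "norm ((LINT t:?S|M. a t - z t) - q *\<^sub>R s) \<le> e"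
    using D_approx whole by simp
  then have "strictly_positive (LINT t:?S|M. a t - z t)"
    by (rule e(2))
  then have "blocks_with_surplus ?S"
    unfolding blocks_with_surplus_def using z better by auto
  moreover have "measure M A \<le> measure M (?S \<inter> \<Union>\<A>)"
    using AT by (intro finite_measure_mono) (auto simp flip: T1_def)
  ultimately show ?thesis
    using A_pos by (intro exI[of _ ?S]) auto
qed

end

section \<open>From ex-post blocking to fine blocking\<close>

text \<open>The property of not cutting \<open>B\<close> holds for blocks and survives complements
  and countable unions.\<close>

lemma sigma_sets_partition_block:
  assumes P: "partition_on \<Omega> P" and B: "B \<in> P" and A: "A \<in> sigma_sets \<Omega> P"
  shows "B \<subseteq> A \<or> B \<inter> A = {}"
  using A
proof induction
  case (Basic C)
  then show ?case
    using P B by (auto simp: partition_on_def dest: disjointD)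
next
  case (Compl C)
  have "B \<subseteq> \<Omega>"
    using P B by (auto simp: partition_on_def)
  with Compl.IH show ?case by blast
qed auto

text \<open>Characteristics are compared through generated algebras, but types through partitions.
  Two blocks sharing a point are measurable for each other's partition, so each contains the
  other.\<close>

lemma partition_on_eqI_sigma_sets:
  assumes P: "partition_on \<Omega> P" and Q: "partition_on \<Omega> Q" and eq: "sigma_sets \<Omega> P = sigma_sets \<Omega> Q"
  shows "P = Q"
proof -
  have "P' \<subseteq> Q'" if P': "partition_on \<Omega> P'" and Q': "partition_on \<Omega> Q'"
    and "sigma_sets \<Omega> P' = sigma_sets \<Omega> Q'" for P' Q'
  proof
    fix B assume B: "B \<in> P'"
    then have "B \<noteq> {}" "B \<subseteq> \<Omega>"
      using partition_onD1[OF P'] partition_onD3[OF P'] by auto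
    then obtain x where x: "x \<in> B" "x \<in> \<Omega>" by blast
    then obtain C where C: "C \<in> Q'" "x \<in> C"
      using partition_onD1[OF Q'] by blast
    have "C \<in> sigma_sets \<Omega> P'" "B \<in> sigma_sets \<Omega> Q'"
      using that B C by (metis sigma_sets.Basic)+
    then have "B \<subseteq> C" "C \<subseteq> B"
      using sigma_sets_partition_block[OF P' B] sigma_sets_partition_block[OF Q' C(1)] x C by blast+
    with C show "B \<in> Q'" by auto
  qed
  from this[OF P Q eq] this[OF Q P eq[symmetric]] show ?thesis by auto
qed

text \<open>\<open>B\<close> is the block of the common refinement at the state; by
  \<open>assumption_A5\<close> this refinement generates all events, so no event cuts
  \<open>B\<close>.\<close>

lemma mixed_economy_state_block:
  fixes E :: "('w, 't, 'l::finite) economy_data"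
  assumes E: "mixed_economy E" and A5: "assumption_A5 E" and \<omega>0: "\<omega>0 \<in> space (states E)"
  obtains B where "\<omega>0 \<in> B" "B \<in> sets (states E)"
    "\<And>A. A \<in> sets (states E) \<Longrightarrow> \<omega>0 \<in> A \<Longrightarrow> B \<subseteq> A"
proof -
  let ?R = "common_refinement (partn E ` {1..npart E})"
  have P: "partition_on (space (states E)) ?R"
    using E by (intro partition_on_common_refinement) (auto simp: mixed_economy_def)
  have sets: "sets (states E) = sigma_sets (space (states E)) ?R"
    using A5 by (simp add: assumption_A5_def join_def)
  obtain B where B: "B \<in> ?R" "\<omega>0 \<in> B"
    using P \<omega>0 by (auto simp: partition_on_def)
  show ?thesis
  proof (rule that)
    show "B \<in> sets (states E)"
      using B unfolding sets by (intro sigma_sets.Basic)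
    show "B \<subseteq> A" if "A \<in> sets (states E)" "\<omega>0 \<in> A" for A
      using sigma_sets_partition_block[OF P B(1)] that B(2) unfolding sets by blast
  qed (use B in auto)
qed

text \<open>Under full information every measurable function falls under the convention on
  measurable functions, so the result depends neither on the chosen versions nor on
  integrability.\<close>

lemma cond_exp_versions_full_information:
  fixes E :: "('w, 't, 'l::finite) economy_data"
  assumes "cond_exp_versions E CE" "t \<in> space (agents E)" "\<omega> \<in> space (states E)"
    "X \<in> borel_measurable (states E)"
  shows "CE t (sets (states E)) X \<omega> = X \<omega>"
proof -
  have "sets (sigma (space (states E)) (sets (states E))) = sets (states E)"
    by simp
  then have "X \<in> borel_measurable (sigma (space (states E)) (sets (states E)))"
    using assms(4) measurable_cong_sets by blast
  then show ?thesis
    using assms(1-3) sets.sigma_algebra_axioms by (auto simp: cond_exp_versions_def)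
qed

text \<open>A coalition containing every type can pool its information into all of the state space's
  algebra. Blocking in one state then becomes fine blocking on the block \<open>B\<close> of that state, on which
  everything measurable is constant.\<close>

lemma fine_blocked_of_blocking_state:
  fixes E :: "('w, 't, 'l::finite) economy_data"
  assumes E: "mixed_economy E" and A1: "assumption_A1' E" and A2: "assumption_A2 E"
    and A3: "assumption_A3 E" and A5: "assumption_A5 E" and CE: "cond_exp_versions E CE"
    and f: "allocation E f" and \<omega>0: "\<omega>0 \<in> space (states E)" and S [measurable]: "S \<in> sets (agents E)"
    and y: "integrable (agents E) y" "\<And>t. t \<in> space (agents E) \<Longrightarrow> y t \<in> orthant"
    and feas: "(LINT t:S|agents E. y t) = (LINT t:S|agents E. endow E t \<omega>0)"
    and better: "AE t in agents E. t \<in> S \<longrightarrow> util E t \<omega>0 (f t \<omega>0) < util E t \<omega>0 (y t)"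
    and active: "active_parts E S = {1..npart E}"
  shows "fine_blocked E CE f S"
proof -
  obtain B where B: "\<omega>0 \<in> B" and Bm [measurable]: "B \<in> sets (states E)"
    and B_min: "\<And>A. A \<in> sets (states E) \<Longrightarrow> \<omega>0 \<in> A \<Longrightarrow> B \<subseteq> A"
    using mixed_economy_state_block[OF E A5 \<omega>0] by blast
  have BS: "\<omega> \<in> space (states E)" if "\<omega> \<in> B" for \<omega>
    using that sets.sets_into_space[OF Bm] by auto
  \<comment> \<open>The level set of \<open>h\<close> through the state is an event, hence contains
    the minimal event \<open>B\<close>.\<close>
  have const: "h \<omega> = h \<omega>0" if h: "h \<in> borel_measurable (states E)" and \<omega>: "\<omega> \<in> B"
    for h :: "'w \<Rightarrow> 'c::t1_space" and \<omega>
  proof -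
    have "h -` {h \<omega>0} \<inter> space (states E) \<in> sets (states E)"
      using h by (rule measurable_sets) simp
    from B_min[OF this] \<omega> \<omega>0 show ?thesis by auto
  qed
  have sub: "S \<subseteq> space (agents E)"
    using S by (rule sets.sets_into_space)
  have endow_meas: "endow E t \<in> borel_measurable (states E)" if "t \<in> space (agents E)" for t
    using measurable_Pair2[OF A1[unfolded assumption_A1'_def, THEN conjunct1] that] by simp
  have endow_int: "integrable (agents E) (\<lambda>t. endow E t \<omega>)" if "\<omega> \<in> space (states E)" for \<omega>
    using A1 that by (auto simp: assumption_A1'_def)
  have endow_orth: "endow E t \<omega> \<in> orthant" if "t \<in> space (agents E)" "\<omega> \<in> space (states E)" for t \<omega>
    using E that by (auto simp: mixed_economy_def)
  have util_meas: "(\<lambda>\<omega>. util E t \<omega> x) \<in> borel_measurable (states E)"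
    if "t \<in> space (agents E)" "x \<in> orthant" for t x
    using measurable_Pair2[OF A2[unfolded assumption_A2_def, rule_format, OF that(2)] that(1)] by simp
  have util_comp: "(\<lambda>\<omega>. util E t \<omega> (h \<omega>)) \<in> borel_measurable (states E)"
    if "t \<in> space (agents E)" "h \<in> borel_measurable (states E)" "\<And>\<omega>. \<omega> \<in> space (states E) \<Longrightarrow> h \<omega> \<in> orthant"
    for t h
    by (rule caratheodory_measurable) (use that A3 in \<open>auto simp: assumption_A3_def intro: util_meas\<close>)
  \<comment> \<open>Fine blocking demands a full allocation: off \<open>B\<close> and outside
    \<open>S\<close> everyone gets the endowment, which keeps \<open>g\<close> feasible in every
    state, because \<open>S\<close> is self-sufficient on \<open>B\<close>.\<close>
  define g where "g t \<omega> = (if t \<in> S \<and> \<omega> \<in> B then y t else endow E t \<omega>)" for t \<omega>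
  have g_orth: "g t \<omega> \<in> orthant" if "t \<in> space (agents E)" "\<omega> \<in> space (states E)" for t \<omega>
    using that y(2) endow_orth by (simp add: g_def)
  have g_meas: "g t \<in> borel_measurable (states E)" if "t \<in> space (agents E)" for t
  proof (cases "t \<in> S")
    case True
    note [measurable] = endow_meas[OF that]
    have "(\<lambda>\<omega>. if \<omega> \<in> B then y t else endow E t \<omega>) \<in> borel_measurable (states E)"
      by measurable
    with True show ?thesis by (simp add: g_def[abs_def])
  next
    case False
    with endow_meas[OF that] show ?thesis by (simp add: g_def[abs_def])
  qed
  have endow_B: "endow E t \<omega> = endow E t \<omega>0" if "t \<in> space (agents E)" "\<omega> \<in> B" for t \<omega>
    using const[OF endow_meas] that by blast
  have g_B: "(LINT t:S|agents E. g t \<omega>) = (LINT t:S|agents E. endow E t \<omega>)" if "\<omega> \<in> B" for \<omega>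
  proof -
    have "(LINT t:S|agents E. g t \<omega>) = (LINT t:S|agents E. y t)"
      using that S by (intro set_lebesgue_integral_cong) (auto simp: g_def)
    also have "\<dots> = (LINT t:S|agents E. endow E t \<omega>)"
      unfolding feas using that S sub endow_B by (intro set_lebesgue_integral_cong) auto
    finally show ?thesis .
  qed
  have g_int: "integrable (agents E) (\<lambda>t. g t \<omega>)" if "\<omega> \<in> space (states E)" for \<omega>
    using integrable_If_set[OF y(1) endow_int[OF that] S] endow_int[OF that]
    by (cases "\<omega> \<in> B") (simp_all add: g_def)
  have g_feas: "(LINT t|agents E. g t \<omega>) = (LINT t|agents E. endow E t \<omega>)"
    if \<omega>: "\<omega> \<in> space (states E)" for \<omega>
  proof (cases "\<omega> \<in> B")
    case True
    let ?d = "\<lambda>t. indicator S t *\<^sub>R g t \<omega> - indicator S t *\<^sub>R endow E t \<omega>"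
    have int: "integrable (agents E) (\<lambda>t. indicator S t *\<^sub>R g t \<omega>)"
      "integrable (agents E) (\<lambda>t. indicator S t *\<^sub>R endow E t \<omega>)"
      using g_int[OF \<omega>] endow_int[OF \<omega>] S by (auto intro: integrable_mult_indicator)
    have "(LINT t|agents E. g t \<omega>) = (LINT t|agents E. endow E t \<omega> + ?d t)"
      by (intro Bochner_Integration.integral_cong) (auto simp: g_def split: split_indicator)
    also have "\<dots> = (LINT t|agents E. endow E t \<omega>) + (LINT t|agents E. ?d t)"
      using int endow_int[OF \<omega>] by (intro Bochner_Integration.integral_add) auto
    also have "(LINT t|agents E. ?d t) = 0"
      using g_B[OF True] int by (simp add: set_lebesgue_integral_def)
    finally show ?thesis by simp
  next
    case False
    then show ?thesis by (simp add: g_def)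
  qed
  have g: "allocation E g"
    using g_orth g_meas g_int g_feas by (auto simp: allocation_def assignment_def)
  \<comment> \<open>Pooling everything is admissible, as all types are active and their join is the
    algebra of all events.\<close>
  define G where "G t = sets (states E)" for t :: 't
  have "communication_system E S G"
    unfolding communication_system_def information_structure_def
  proof (intro conjI ballI allI impI)
    show "sigma_algebra (space (states E)) (G t)" "G t \<subseteq> sets (states E)" for t
      by (simp_all add: G_def sets.sigma_algebra_axioms)
    show "{t \<in> S. G t = \<G>} \<in> sets (agents E)" for \<G>
      using S by (cases "\<G> = sets (states E)") (auto simp: G_def)
    have "info_algebra E t \<subseteq> G t" "G t \<subseteq> join E (active_parts E S)" if "t \<in> space (agents E)" for t
    proof -
      have "info E t \<subseteq> sets (states E)"
        using E that by (fastforce simp: mixed_economy_def)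
      then show "info_algebra E t \<subseteq> G t"
        unfolding info_algebra_def G_def by (rule sets.sigma_sets_subset)
      show "G t \<subseteq> join E (active_parts E S)"
        using A5 by (simp add: G_def active assumption_A5_def)
    qed
    then show "AE t in agents E. t \<in> S \<longrightarrow> info_algebra E t \<subseteq> G t \<and> G t \<subseteq> join E (active_parts E S)"
      by (intro AE_I2) auto
  qed
  moreover have "AE t in agents E. t \<in> S \<longrightarrow>
      CE t (G t) (\<lambda>\<omega>'. util E t \<omega>' (g t \<omega>')) \<omega> > CE t (G t) (\<lambda>\<omega>'. util E t \<omega>' (f t \<omega>')) \<omega>"
    if \<omega>: "\<omega> \<in> B" for \<omega>
    using better AE_space
  proof eventually_elim
    case (elim t)
    show ?case
    proof
      assume "t \<in> S"
      \<comment> \<open>The conditional expectation is the utility itself, which is constant on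
        \<open>B\<close>; the comparison thus reduces to the one at the blocking state.\<close>
      have eval: "CE t (G t) (\<lambda>\<omega>'. util E t \<omega>' (h t \<omega>')) \<omega> = util E t \<omega>0 (h t \<omega>0)"
        if "allocation E h" for h
      proof -
        have X: "(\<lambda>\<omega>'. util E t \<omega>' (h t \<omega>')) \<in> borel_measurable (states E)"
          using that elim by (intro util_comp) (auto simp: allocation_def assignment_def)
        show ?thesis
          unfolding G_def
          using cond_exp_versions_full_information[OF CE elim(2) BS[OF \<omega>] X] const[OF X \<omega>] by simp
      qed
      have "g t \<omega>0 = y t"
        using \<open>t \<in> S\<close> B by (simp add: g_def)
      with eval[OF f] eval[OF g] elim(1) \<open>t \<in> S\<close>
      show "CE t (G t) (\<lambda>\<omega>'. util E t \<omega>' (g t \<omega>')) \<omega> > CE t (G t) (\<lambda>\<omega>'. util E t \<omega>' (f t \<omega>')) \<omega>"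
        by simp
    qed
  qed
  ultimately show ?thesis
    unfolding fine_blocked_def using g g_B B Bm
    by (intro exI[of _ g] exI[of _ G] exI[of _ B]) (auto simp: G_def)
qed

section \<open>Reaching every information type\<close>

lemma mixed_economy_large:
  fixes E :: "('w, 't, 'l::finite) economy_data"
  assumes "mixed_economy E"
  shows "large_part E \<in> sets (agents E)" "atomless_on (agents E) (space (agents E) - large_part E)"
proof -
  show "large_part E \<in> sets (agents E)"
    unfolding large_part_def using assms by (intro sets.countable_Union) (auto simp: mixed_economy_def measure_atom_def)
  then show "atomless_on (agents E) (space (agents E) - large_part E)"
    using assms by (auto simp: atomless_on_def mixed_economy_def small_part_def)
qed

text \<open>The order of the enlargements matters: a large trader is secured first, then every type
  that is still missing has small agents in positive measure and is reached through them.\<close>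

lemma ex_post_blocked_imp_fully_informed_blocking:
  fixes E :: "('w, 't, 'l::finite) economy_data"
  assumes E: "mixed_economy E" and A1: "assumption_A1' E" and A2: "assumption_A2 E"
    and A3: "assumption_A3 E" and A4: "assumption_A4' E" and A5: "assumption_A5 E" and A6: "assumption_A6 E"
    and large: "infinite (large E) \<or> card (large E) \<ge> 2 \<or> large E = {}"
    and f: "allocation E f" and S: "coalition E S"
    and \<omega>0: "\<omega>0 \<in> space (states E)" and g: "assignment E g"
    and feas: "(LINT t:S|agents E. g t \<omega>0) = (LINT t:S|agents E. endow E t \<omega>0)"
    and better: "AE t in agents E. t \<in> S \<longrightarrow> util E t \<omega>0 (f t \<omega>0) < util E t \<omega>0 (g t \<omega>0)"
  obtains S' y where "S' \<in> sets (agents E)" "0 < emeasure (agents E) S'" "active_parts E S' = {1..npart E}"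
    "integrable (agents E) y" "\<And>t. t \<in> space (agents E) \<Longrightarrow> y t \<in> orthant"
    "(LINT t:S'|agents E. y t) = (LINT t:S'|agents E. endow E t \<omega>0)"
    "AE t in agents E. t \<in> S' \<longrightarrow> util E t \<omega>0 (f t \<omega>0) < util E t \<omega>0 (y t)"
proof -
  have fin: "finite_measure (agents E)"
    using E by (auto simp: mixed_economy_def)
  have ex: "pure_exchange (agents E) (\<lambda>t. util E t \<omega>0) (\<lambda>t. endow E t \<omega>0) (\<lambda>t. f t \<omega>0)"
  proof (intro pure_exchange.intro fin pure_exchange_axioms.intro)
    show "(\<lambda>t. util E t \<omega>0 x) \<in> borel_measurable (agents E)" if "x \<in> orthant" for x
      using measurable_Pair1[OF A2[unfolded assumption_A2_def, rule_format, OF that] \<omega>0] by simp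
  qed (use A1 A3 f \<omega>0 in \<open>auto simp: assumption_A1'_def assumption_A3_def allocation_def assignment_def\<close>)
  interpret pure_exchange "agents E" "\<lambda>t. util E t \<omega>0" "\<lambda>t. endow E t \<omega>0" "\<lambda>t. f t \<omega>0"
    by (rule ex)
  let ?M = "agents E"
  note T1 = mixed_economy_large[OF E]
  let ?T = "\<lambda>i. members_with E (space ?M) i"
  have T: "?T i \<in> sets ?M" "0 < measure ?M (?T i)" if "i \<in> {1..npart E}" for i
    using E A5 that by (auto simp: mixed_economy_def assumption_A5_def emeasure_eq_measure)
  have "blocks S"
    unfolding blocks_def bundles_def
    using S g \<omega>0 feas better by (auto simp: coalition_def assignment_def)
  moreover have "0 < measure ?M S"
    using S by (simp add: coalition_def emeasure_eq_measure)
  ultimately have S_surplus: "blocks_with_surplus S"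
    using A1 \<omega>0 by (intro blocks_imp_blocks_with_surplus) (auto simp: assumption_A1'_def)
  have "\<exists>S1. blocks_with_surplus S1 \<and> (large E \<noteq> {} \<longrightarrow> 0 < measure ?M (S1 \<inter> large_part E))"
  proof (cases "large E = {} \<or> measure ?M (S \<inter> large_part E) \<noteq> 0")
    case True
    then show ?thesis
      using S_surplus by (intro exI[of _ S]) (auto simp: zero_less_measure_iff)
  next
    case False
    then have "large E \<noteq> {}" and null: "measure ?M (S \<inter> \<Union>(large E)) = 0"
      by (auto simp: large_part_def)
    with large have "\<not> card (large E) \<le> Suc 0 \<or> infinite (large E)" by auto
    then have two: "\<exists>A\<in>large E. \<exists>B\<in>large E. A \<noteq> B"
      using \<open>large E \<noteq> {}\<close> by (metis card_le_Suc0_iff_eq finite.emptyI finite_insert insert_iff subsetI finite_subset)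
    obtain A where A: "A \<in> large E" "measure_atom ?M A"
      using \<open>large E \<noteq> {}\<close> E by (auto simp: mixed_economy_def)
    then have "A \<noteq> {}"
      by (auto simp: measure_atom_def)
    with A(1) obtain t0 where t0: "t0 \<in> large_part E"
      by (auto simp: large_part_def)
    have same: "same_characteristics E t t0" if "t \<in> large_part E" for t
      using A6 t0 that by (auto simp: assumption_A6_def)
    interpret large_traders "agents E" "\<lambda>t. util E t \<omega>0" "\<lambda>t. endow E t \<omega>0" "\<lambda>t. f t \<omega>0"
      "large E" "util E t0 \<omega>0" "endow E t0 \<omega>0"
    proof
      show "countable (large E)" "disjoint (large E)" "\<And>A. A \<in> large E \<Longrightarrow> measure_atom ?M A"
        using E by (auto simp: mixed_economy_def)
      show "atomless_on ?M (space ?M - \<Union>(large E))"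
        using T1(2) by (simp add: large_part_def)
      show "\<And>t x. t \<in> \<Union>(large E) \<Longrightarrow> x \<in> orthant \<Longrightarrow> util E t \<omega>0 x = util E t0 \<omega>0 x"
        "\<And>t. t \<in> \<Union>(large E) \<Longrightarrow> endow E t \<omega>0 = endow E t0 \<omega>0"
        using same \<omega>0 by (auto simp: same_characteristics_def large_part_def)
      show "quasi_concave_on orthant (util E t0 \<omega>0)"
        using A4 t0 \<omega>0 by (auto simp: assumption_A4'_def)
      show "(LINT t|?M. f t \<omega>0) = (LINT t|?M. endow E t \<omega>0)"
        using f \<omega>0 by (auto simp: allocation_def)
    qed (rule two)
    show ?thesis
      using blocks_with_surplus_absorb_atom[OF S_surplus null] by (auto simp: large_part_def)
  qed
  then obtain S1 where S1: "blocks_with_surplus S1" "large E \<noteq> {} \<Longrightarrow> 0 < measure ?M (S1 \<inter> large_part E)"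
    by blast
  have S1_sets: "S1 \<in> sets ?M"
    using S1 by (simp add: blocks_with_surplus_def)
  let ?N = "space ?M - large_part E"
  \<comment> \<open>A type without small agents in positive measure contains a large one, hence all
    of them, and \<open>S1\<close> already meets the large part in positive measure.\<close>
  have reach: "0 < measure ?M (S1 \<inter> ?T i) \<or> 0 < measure ?M (?T i \<inter> ?N)" if i: "i \<in> {1..npart E}" for i
  proof (rule disjCI)
    assume "\<not> 0 < measure ?M (?T i \<inter> ?N)"
    then have null: "measure ?M (?T i \<inter> ?N) = 0"
      by (simp add: zero_less_measure_iff)
    have "?T i = (?T i \<inter> ?N) \<union> (?T i \<inter> large_part E)"
      by (auto simp: members_with_def)
    then have "measure ?M (?T i) \<le> measure ?M (?T i \<inter> ?N) + measure ?M (?T i \<inter> large_part E)"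
      using T(1)[OF i] T1(1) by (metis measure_Un_le sets.Int sets.Diff sets.top)
    with T(2)[OF i] null have "?T i \<inter> large_part E \<noteq> {}"
      by auto
    then obtain t where t: "t \<in> ?T i" "t \<in> large_part E" by auto
    \<comment> \<open>\<open>assumption_A6\<close> only equates the generated algebras; since both
      come from partitions, the partitions agree too.\<close>
    have info: "info E s = info E t" if "s \<in> large_part E" for s
    proof (rule partition_on_eqI_sigma_sets)
      have "s \<in> space ?M" "t \<in> space ?M"
        using that t(2) sets.sets_into_space[OF T1(1)] by auto
      then show "partition_on (space (states E)) (info E s)" "partition_on (space (states E)) (info E t)"
        using E unfolding mixed_economy_def by (metis imageE)+
      show "sigma_sets (space (states E)) (info E s) = sigma_sets (space (states E)) (info E t)"
        using A6 that t(2) unfolding assumption_A6_def same_characteristics_def info_algebra_def by blast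
    qed
    have "large_part E \<subseteq> ?T i"
    proof
      fix s assume s: "s \<in> large_part E"
      then show "s \<in> ?T i"
        using t(1) info[OF s] sets.sets_into_space[OF T1(1)] unfolding members_with_def by auto
    qed
    then have "measure ?M (S1 \<inter> large_part E) \<le> measure ?M (S1 \<inter> ?T i)"
      using S1_sets T(1)[OF i] by (intro finite_measure_mono) auto
    moreover have "large E \<noteq> {}"
      using t(2) by (auto simp: large_part_def)
    ultimately show "0 < measure ?M (S1 \<inter> ?T i)"
      using S1(2) by simp
  qed
  obtain S' where S': "blocks_with_surplus S'" "\<forall>i\<in>{1..npart E}. 0 < measure ?M (S' \<inter> ?T i)"
    using blocks_with_surplus_enlarge_family[OF _ S1(1) T1(2), of "{1..npart E}" ?T] T(1) reach by auto
  obtain y where y: "S' \<in> sets ?M" "y \<in> bundles"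
    "AE t in ?M. t \<in> S' \<longrightarrow> util E t \<omega>0 (f t \<omega>0) < util E t \<omega>0 (y t)"
    "(LINT t:S'|?M. y t) = (LINT t:S'|?M. endow E t \<omega>0)"
    using blocks_with_surplus_imp_blocks[OF S'(1)] by (auto simp: blocks_def)
  have "members_with E S' i = S' \<inter> ?T i" for i
    using sets.sets_into_space[OF y(1)] by (auto simp: members_with_def)
  then have "active_parts E S' = {1..npart E}"
    using S'(2) by (auto simp: active_parts_def emeasure_eq_measure)
  moreover have "0 < emeasure ?M S'"
    using blocks_with_surplus_pos[OF S'(1)] by (simp add: emeasure_eq_measure)
  ultimately show ?thesis
    using y that by (auto simp: bundles_def)
qed

theorem theorem4p6:
  fixes E :: "('w, 't, 'l::finite) economy_data"
    and CE :: "'t \<Rightarrow> 'w set set \<Rightarrow> ('w \<Rightarrow> real) \<Rightarrow> 'w \<Rightarrow> real"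
  assumes "mixed_economy E"
    and "assumption_A1' E"
    and "assumption_A2 E"
    and "assumption_A3 E"
    and "assumption_A4' E"
    and "assumption_A5 E"
    and "assumption_A6 E"
    and "cond_exp_versions E CE"
    and "(infinite (large E) \<or> card (large E) \<ge> 2) \<or> large E = {}"
  shows "fine_core E CE \<subseteq> ex_post_core E"
proof
  fix f assume "f \<in> fine_core E CE"
  then have f: "allocation E f" and core: "\<And>S. coalition E S \<Longrightarrow> \<not> fine_blocked E CE f S"
    by (auto simp: fine_core_def)
  have False if S: "coalition E S" and blocked: "ex_post_blocked E f S" for S
  proof -
    obtain \<omega>0 g where \<omega>0: "\<omega>0 \<in> space (states E)" and g: "assignment E g"
      "(LINT t:S|agents E. g t \<omega>0) = (LINT t:S|agents E. endow E t \<omega>0)"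
      "AE t in agents E. t \<in> S \<longrightarrow> util E t \<omega>0 (g t \<omega>0) > util E t \<omega>0 (f t \<omega>0)"
      using blocked by (auto simp: ex_post_blocked_def)
    have large: "infinite (large E) \<or> card (large E) \<ge> 2 \<or> large E = {}"
      using assms(9) by blast
    obtain S' y where S': "S' \<in> sets (agents E)" "0 < emeasure (agents E) S'"
        "active_parts E S' = {1..npart E}"
      and y: "integrable (agents E) y" "\<And>t. t \<in> space (agents E) \<Longrightarrow> y t \<in> orthant"
        "(LINT t:S'|agents E. y t) = (LINT t:S'|agents E. endow E t \<omega>0)"
        "AE t in agents E. t \<in> S' \<longrightarrow> util E t \<omega>0 (f t \<omega>0) < util E t \<omega>0 (y t)"
      using ex_post_blocked_imp_fully_informed_blocking[OF assms(1-7) large f S \<omega>0 g] by blast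
    have "fine_blocked E CE f S'"
      using assms(1-4,6,8) f \<omega>0 S'(1) y S'(3) by (rule fine_blocked_of_blocking_state)
    with core[of S'] S' show False
      by (simp add: coalition_def)
  qed
  with f show "f \<in> ex_post_core E"
    by (auto simp: ex_post_core_def)
qed

end
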